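(* Let $\mathscr G$ be an ample Hausdorff groupoid. Then $C_c(\mathscr G)$ is simple if and only if $\mathscr G$ is minimal and effective.
   Context: "Compact" includes Hausdorff. A groupoid $\mathscr G$ (identified with its set of arrows) has unit space $\mathscr G^{(0)}$, $\boldsymbol d(\gamma)=\gamma^{-1}\gamma$, $\boldsymbol r(\gamma)=\gamma\gamma^{-1}$. It is ample if it is a topological groupoid such that $\mathscr G^{(0)}$ is locally compact Hausdorff with a basis of compact open sets and $\boldsymbol r$ is a local homeomorphism. A bisection is a subset on which $\boldsymbol d$ and $\boldsymbol r$ are injective. $C_c(\mathscr G)$ is the complex span of the functions $f:\mathscr G\to\mathbb C$ for which there is a compact open bisection $U$ such that $f$ vanishes outside $U$ and $f|_U$ is continuous ($\mathbb C$ with its usual topology); it is a ring under pointwise addition and convolution $(f*g)(\gamma)=\sum_{\beta\rho=\gamma}f(\beta)g(\rho)$. It is simple if its only two-sided ideals (no closure or topology involved) are $\{0\}$ and itself. $\mathscr G$ is effective if $\mathscr G^{(0)}$ equals the interior of $\mathrm{Iso}(\mathscr G)=\{g\in\mathscr G:\boldsymbol d(g)=\boldsymbol r(g)\}$. A subset $D\subseteq\mathscr G^{(0)}$ is invariant if for all $\gamma\in\mathscr G$, $\boldsymbol d(\gamma)\in D$ iff $\boldsymbol r(\gamma)\in D$. $\mathscr G$ is minimal if the only open invariant subsets of $\mathscr G^{(0)}$ are $\emptyset$ and $\mathscr G^{(0)}$. *)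

theory Defs
  imports "HOL-Analysis.Analysis" "HOL-Library.Function_Algebras"
begin

section \<open>Groupoids\<close>

record 'a groupoid =
  arrows :: "'a set"
  composable :: "('a \<times> 'a) set"
  mult :: "'a \<Rightarrow> 'a \<Rightarrow> 'a" (infixl \<open>\<cdot>\<index>\<close> 70)
  inverse_arrow :: "'a \<Rightarrow> 'a"

definition source :: "('a, 'm) groupoid_scheme \<Rightarrow> 'a \<Rightarrow> 'a" where
  "source G \<gamma> = mult G (inverse_arrow G \<gamma>) \<gamma>"

definition range_map :: "('a, 'm) groupoid_scheme \<Rightarrow> 'a \<Rightarrow> 'a" where
  "range_map G \<gamma> = mult G \<gamma> (inverse_arrow G \<gamma>)"

definition units :: "('a, 'm) groupoid_scheme \<Rightarrow> 'a set" where
  "units G = source G ` arrows G"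

definition isotropy :: "('a, 'm) groupoid_scheme \<Rightarrow> 'a set" where
  "isotropy G = {\<gamma> \<in> arrows G. source G \<gamma> = range_map G \<gamma>}"

text \<open>The usual axioms for a groupoid identified with its set of arrows. They imply that
  \<open>\<beta>\<close> and \<open>\<rho>\<close> are composable iff \<open>source G \<beta> = range_map G \<rho>\<close>, and that units are
  two-sided identities. The set of arrows may be empty.\<close>

locale groupoid =
  fixes G :: "('a, 'm) groupoid_scheme" (structure)
  assumes composable_subset: "composable G \<subseteq> arrows G \<times> arrows G"
    and mult_closed: "(x, y) \<in> composable G \<Longrightarrow> x \<cdot> y \<in> arrows G"
    and inverse_closed: "x \<in> arrows G \<Longrightarrow> inverse_arrow G x \<in> arrows G"
    and inverse_inverse: "x \<in> arrows G \<Longrightarrow> inverse_arrow G (inverse_arrow G x) = x"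
    and composable_mult_left:
      "\<lbrakk>(x, y) \<in> composable G; (y, z) \<in> composable G\<rbrakk> \<Longrightarrow> (x \<cdot> y, z) \<in> composable G"
    and composable_mult_right:
      "\<lbrakk>(x, y) \<in> composable G; (y, z) \<in> composable G\<rbrakk> \<Longrightarrow> (x, y \<cdot> z) \<in> composable G"
    and mult_assoc:
      "\<lbrakk>(x, y) \<in> composable G; (y, z) \<in> composable G\<rbrakk> \<Longrightarrow> (x \<cdot> y) \<cdot> z = x \<cdot> (y \<cdot> z)"
    and composable_inverse_left: "x \<in> arrows G \<Longrightarrow> (inverse_arrow G x, x) \<in> composable G"
    and composable_inverse_right: "x \<in> arrows G \<Longrightarrow> (x, inverse_arrow G x) \<in> composable G"
    and cancel_left: "(x, y) \<in> composable G \<Longrightarrow> inverse_arrow G x \<cdot> (x \<cdot> y) = y"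
    and cancel_right: "(x, y) \<in> composable G \<Longrightarrow> (x \<cdot> y) \<cdot> inverse_arrow G y = x"


section \<open>Ample groupoids\<close>

definition compact_hausdorff_in :: "'a topology \<Rightarrow> 'a set \<Rightarrow> bool" where
  "compact_hausdorff_in X K \<longleftrightarrow> compactin X K \<and> Hausdorff_space (subtopology X K)"

definition local_homeomorphism :: "'a topology \<Rightarrow> 'b topology \<Rightarrow> ('a \<Rightarrow> 'b) \<Rightarrow> bool" where
  "local_homeomorphism X Y f \<longleftrightarrow>
     (\<forall>x \<in> topspace X. \<exists>U. openin X U \<and> x \<in> U \<and> openin Y (f ` U) \<and>
        homeomorphic_map (subtopology X U) (subtopology Y (f ` U)) f)"

record 'a top_groupoid = "'a groupoid" +
  arrow_topology :: "'a topology"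

definition unit_space :: "('a, 'm) top_groupoid_scheme \<Rightarrow> 'a topology" where
  "unit_space G = subtopology (arrow_topology G) (units G)"

locale topological_groupoid = groupoid G
  for G :: "('a, 'm) top_groupoid_scheme" (structure) +
  assumes topspace_arrow_topology: "topspace (arrow_topology G) = arrows G"
    and continuous_mult:
      "continuous_map
         (subtopology (prod_topology (arrow_topology G) (arrow_topology G)) (composable G))
         (arrow_topology G) (\<lambda>(x, y). x \<cdot> y)"
    and continuous_inverse:
      "continuous_map (arrow_topology G) (arrow_topology G) (inverse_arrow G)"

locale ample_groupoid = topological_groupoid G
  for G :: "('a, 'm) top_groupoid_scheme" (structure) +
  assumes locally_compact_unit_space: "locally_compact_space (unit_space G)"
    and Hausdorff_unit_space: "Hausdorff_space (unit_space G)"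
    and compact_open_basis:
      "\<exists>\<B>. (\<forall>K \<in> \<B>. openin (unit_space G) K \<and> compact_hausdorff_in (unit_space G) K) \<and>
           openin (unit_space G) = arbitrary union_of (\<lambda>K. K \<in> \<B>)"
    and range_local_homeomorphism:
      "local_homeomorphism (arrow_topology G) (unit_space G) (range_map G)"

definition effective :: "('a, 'm) top_groupoid_scheme \<Rightarrow> bool" where
  "effective G \<longleftrightarrow> units G = arrow_topology G interior_of isotropy G"

definition invariant_units :: "('a, 'm) groupoid_scheme \<Rightarrow> 'a set \<Rightarrow> bool" where
  "invariant_units G D \<longleftrightarrow>
     D \<subseteq> units G \<and> (\<forall>\<gamma> \<in> arrows G. source G \<gamma> \<in> D \<longleftrightarrow> range_map G \<gamma> \<in> D)"

definition minimal :: "('a, 'm) top_groupoid_scheme \<Rightarrow> bool" where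
  "minimal G \<longleftrightarrow>
     (\<forall>D. openin (unit_space G) D \<and> invariant_units G D \<longrightarrow> D = {} \<or> D = units G)"


section \<open>The convolution ring\<close>

definition bisection :: "('a, 'm) groupoid_scheme \<Rightarrow> 'a set \<Rightarrow> bool" where
  "bisection G U \<longleftrightarrow> U \<subseteq> arrows G \<and> inj_on (source G) U \<and> inj_on (range_map G) U"

global_interpretation cfun: vector_space "\<lambda>(c::complex) (f::'a \<Rightarrow> complex) x. c * f x"
  by unfold_locales (auto simp: fun_eq_iff algebra_simps)

text \<open>Functions on the arrows are represented by functions on the whole type that vanish
  outside \<open>arrows G\<close>. The generators need not be continuous on \<open>arrows G\<close> when the groupoid is
  not Hausdorff.\<close>

definition Cc_generators :: "('a, 'm) top_groupoid_scheme \<Rightarrow> ('a \<Rightarrow> complex) set" where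
  "Cc_generators G = {f. \<exists>U. openin (arrow_topology G) U \<and>
     compact_hausdorff_in (arrow_topology G) U \<and> bisection G U \<and>
     (\<forall>\<gamma>. \<gamma> \<notin> U \<longrightarrow> f \<gamma> = 0) \<and>
     continuous_map (subtopology (arrow_topology G) U) euclidean f}"

definition Cc :: "('a, 'm) top_groupoid_scheme \<Rightarrow> ('a \<Rightarrow> complex) set" where
  "Cc G = cfun.span (Cc_generators G)"

text \<open>There may be infinitely many factorisations of an arrow, but for functions in \<open>Cc G\<close> only
  finitely many of them contribute. Since \<open>sum\<close> is \<open>0\<close> on infinite index sets, the sum has to
  be restricted to the nonzero terms.\<close>

definition convolution ::
    "('a, 'm) groupoid_scheme \<Rightarrow> ('a \<Rightarrow> complex) \<Rightarrow> ('a \<Rightarrow> complex) \<Rightarrow> 'a \<Rightarrow> complex" where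
  "convolution G f g \<gamma> =
     (\<Sum>(\<beta>, \<rho>) \<in> {(\<beta>, \<rho>) \<in> composable G. mult G \<beta> \<rho> = \<gamma> \<and> f \<beta> * g \<rho> \<noteq> 0}. f \<beta> * g \<rho>)"

text \<open>The ring is in general not unital, so ideals as in HOL-Algebra, which presuppose a unit,
  are not available. Here \<open>R\<close> is the carrier of a ring whose addition is that of the ambient
  type and whose product is \<open>times_R\<close>.\<close>

definition two_sided_ideal ::
    "'b::ab_group_add set \<Rightarrow> ('b \<Rightarrow> 'b \<Rightarrow> 'b) \<Rightarrow> 'b set \<Rightarrow> bool" where
  "two_sided_ideal R times_R I \<longleftrightarrow>
     I \<subseteq> R \<and> 0 \<in> I \<and> (\<forall>a \<in> I. \<forall>b \<in> I. a + b \<in> I) \<and> (\<forall>a \<in> I. - a \<in> I) \<and>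
     (\<forall>x \<in> R. \<forall>a \<in> I. times_R x a \<in> I \<and> times_R a x \<in> I)"

definition simple_ring :: "'b::ab_group_add set \<Rightarrow> ('b \<Rightarrow> 'b \<Rightarrow> 'b) \<Rightarrow> bool" where
  "simple_ring R times_R \<longleftrightarrow> (\<forall>I. two_sided_ideal R times_R I \<longrightarrow> I = {0} \<or> I = R)"

end

(* If D is a nontrivial open invariant set, the functions supported on arrows with source in D form
   an ideal.  C_c(G) acts on the finitely supported functions on the unit space, an arrow moving its
   source to its range; if B is a compact open bisection of isotropy arrows, then 1_B - 1_r(B) lies
   in the kernel, so simplicity forces B to consist of units.
   Conversely, let f be nonzero in an ideal I.  Translating by a bisection makes f nonzero at some
   unit.  By effectiveness there is an open set V of units near it such that f vanishes on the
   non-units with source and range in V, so cutting f down to a compact open W inside V and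
   dividing by it gives 1_W in I.  The union of all compact open W with 1_W in I is open and, by
   conjugation with bisections, invariant; minimality makes it the whole unit space, and every
   generator f is 1_W f for a suitable W. *)
theory Submission
  imports Defs
begin

section \<open>Groupoid algebra\<close>

text \<open>Hausdorffness enters mainly through two facts: compact open bisections are clopen, and
  the unit space is closed. The first identifies \<open>Cc G\<close> with the continuous functions
  of compact support, so that membership of a product becomes a topological check instead of a
  decomposition into generators. The second makes the non-units of an open bisection an open set, to
  which effectiveness can be applied. The action on functions on the unit space sees only the sum of
  f over all arrows from u to v. It cannot tell an isotropy arrow from the unit at its range, which
  is why the difference of indicators dies, while the indicator of a nonempty set of units survives.
  The cutting-down step looks for no unit with trivial isotropy. A function is a finite sum of
  functions on bisections, and a nonempty open set of units is shrunk once for each of them. Since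
  nonvanishing holds on an open set, the shrunken set may move away from the unit found at
  first.\<close>

context groupoid
begin

abbreviation src :: "'a \<Rightarrow> 'a" where "src \<equiv> source G"
abbreviation rng :: "'a \<Rightarrow> 'a" where "rng \<equiv> range_map G"
abbreviation iv :: "'a \<Rightarrow> 'a" where "iv \<equiv> inverse_arrow G"

lemma composable_arrows:
  assumes "(x, y) \<in> composable G"
  shows "x \<in> arrows G" "y \<in> arrows G"
  using assms composable_subset by auto

lemma src_iv [simp]: "x \<in> arrows G \<Longrightarrow> src (iv x) = rng x"
  by (simp add: source_def range_map_def inverse_inverse)

lemma rng_iv [simp]: "x \<in> arrows G \<Longrightarrow> rng (iv x) = src x"
  by (simp add: source_def range_map_def inverse_inverse)

lemma src_arrow [simp]: "x \<in> arrows G \<Longrightarrow> src x \<in> arrows G"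
  unfolding source_def by (intro mult_closed composable_inverse_left)

lemma rng_arrow [simp]: "x \<in> arrows G \<Longrightarrow> rng x \<in> arrows G"
  unfolding range_map_def by (intro mult_closed composable_inverse_right)

lemma src_units [simp]: "x \<in> arrows G \<Longrightarrow> src x \<in> units G"
  by (auto simp: units_def)

lemma rng_units [simp]: "x \<in> arrows G \<Longrightarrow> rng x \<in> units G"
  by (metis src_iv src_units inverse_closed)

lemma units_subset: "units G \<subseteq> arrows G"
  by (auto simp: units_def)

lemma units_arrow [simp]: "u \<in> units G \<Longrightarrow> u \<in> arrows G"
  using units_subset by auto

lemma mult_src [simp]: "x \<in> arrows G \<Longrightarrow> x \<cdot> src x = x"
  by (metis source_def cancel_left composable_inverse_left inverse_inverse)

lemma rng_mult_self [simp]: "x \<in> arrows G \<Longrightarrow> rng x \<cdot> x = x"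
  by (metis range_map_def cancel_right composable_inverse_right inverse_closed inverse_inverse)

lemma composable_src: "x \<in> arrows G \<Longrightarrow> (x, src x) \<in> composable G"
  unfolding source_def
  by (rule composable_mult_right[OF composable_inverse_right composable_inverse_left])

lemma composable_rng: "x \<in> arrows G \<Longrightarrow> (rng x, x) \<in> composable G"
  unfolding range_map_def
  by (rule composable_mult_left[OF composable_inverse_right composable_inverse_left])

text \<open>If \<open>x\<close> and \<open>y\<close> compose, then \<open>src x\<close> composes
  with \<open>y\<close> and fixes it, and cancelling \<open>y\<close> on the right leaves
  \<open>src x = rng y\<close>. Conversely, \<open>x\<close> composes with its source and
  \<open>rng y\<close> with \<open>y\<close>.\<close>

lemma composable_iff:
  "(x, y) \<in> composable G \<longleftrightarrow> x \<in> arrows G \<and> y \<in> arrows G \<and> src x = rng y"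
proof
  assume c: "(x, y) \<in> composable G"
  note xy = composable_arrows[OF c]
  have u: "(src x, y) \<in> composable G"
    unfolding source_def by (rule composable_mult_left[OF composable_inverse_left[OF xy(1)] c])
  have "src x \<cdot> y = y"
    unfolding source_def
    using mult_assoc[OF composable_inverse_left[OF xy(1)] c] cancel_left[OF c] by simp
  then have "src x = rng y"
    using cancel_right[OF u] by (simp add: range_map_def)
  then show "x \<in> arrows G \<and> y \<in> arrows G \<and> src x = rng y" using xy by simp
next
  assume xy: "x \<in> arrows G \<and> y \<in> arrows G \<and> src x = rng y"
  then have "(x \<cdot> src x, y) \<in> composable G"
    by (metis composable_mult_left composable_src composable_rng)
  then show "(x, y) \<in> composable G"
    using xy by (metis mult_src)
qed

lemma mult_arrow [simp]:
  "x \<in> arrows G \<Longrightarrow> y \<in> arrows G \<Longrightarrow> src x = rng y \<Longrightarrow> x \<cdot> y \<in> arrows G"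
  by (simp add: composable_iff mult_closed)

lemma rng_mult [simp]:
  assumes "x \<in> arrows G" "y \<in> arrows G" "src x = rng y"
  shows "rng (x \<cdot> y) = rng x"
proof -
  have "(iv x, x \<cdot> y) \<in> composable G"
    using assms by (intro composable_mult_right composable_inverse_left) (auto simp: composable_iff)
  then show ?thesis using assms(1) by (simp add: composable_iff)
qed

lemma src_mult [simp]:
  assumes "x \<in> arrows G" "y \<in> arrows G" "src x = rng y"
  shows "src (x \<cdot> y) = src y"
proof -
  have "(x \<cdot> y, iv y) \<in> composable G"
    using assms by (intro composable_mult_left composable_inverse_right) (auto simp: composable_iff)
  then show ?thesis using assms(2) by (simp add: composable_iff)
qed

declare inverse_closed [simp] inverse_inverse [simp]

lemma src_src [simp]: "x \<in> arrows G \<Longrightarrow> src (src x) = src x"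
  using src_mult[of "iv x" x] by (simp add: source_def[symmetric])

lemma rng_src [simp]: "x \<in> arrows G \<Longrightarrow> rng (src x) = src x"
  using rng_mult[of "iv x" x] by (simp add: source_def[symmetric])

lemma src_unit [simp]: "u \<in> units G \<Longrightarrow> src u = u"
  by (auto simp: units_def)

lemma rng_unit [simp]: "u \<in> units G \<Longrightarrow> rng u = u"
  by (metis imageE rng_src units_def)

lemma iv_unit [simp]: "u \<in> units G \<Longrightarrow> iv u = u"
  using mult_src[of "iv u"] source_def[of G u] by simp

lemma units_iff: "x \<in> units G \<longleftrightarrow> x \<in> arrows G \<and> rng x = x"
  using rng_units[of x] by (metis rng_unit units_arrow)

lemma iv_mult_cancel [simp]:
  "x \<in> arrows G \<Longrightarrow> y \<in> arrows G \<Longrightarrow> src x = rng y \<Longrightarrow> iv x \<cdot> (x \<cdot> y) = y"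
  by (simp add: cancel_left composable_iff)

lemma mult_iv_cancel [simp]:
  "x \<in> arrows G \<Longrightarrow> y \<in> arrows G \<Longrightarrow> rng x = rng y \<Longrightarrow> x \<cdot> (iv x \<cdot> y) = y"
  using iv_mult_cancel[of "iv x" y] by simp

lemma iv_mult [simp]:
  assumes "x \<in> arrows G" "y \<in> arrows G" "src x = rng y"
  shows "iv (x \<cdot> y) = iv y \<cdot> iv x"
proof -
  have "iv y = iv (x \<cdot> y) \<cdot> x"
    using cancel_left[of "x \<cdot> y" "iv y"] cancel_right[of x y] assms by (simp add: composable_iff)
  then show ?thesis
    using cancel_right[of "iv (x \<cdot> y)" x] assms by (simp add: composable_iff)
qed

lemma bisection_iv:
  assumes "bisection G U" shows "bisection G (iv ` U)"
  using assms unfolding bisection_def inj_on_def by (auto simp: subset_iff)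

lemma bisection_units: "U \<subseteq> units G \<Longrightarrow> bisection G U"
  unfolding bisection_def inj_on_def using units_subset by (auto simp: subset_iff)

lemma bisection_subset: "bisection G U \<Longrightarrow> V \<subseteq> U \<Longrightarrow> bisection G V"
  unfolding bisection_def by (meson inj_on_subset subset_trans)


section \<open>Convolution\<close>

text \<open>The involution without complex conjugation, hence a linear anti-automorphism; it
  converts statements about left multiplication into statements about right multiplication.\<close>

definition star :: "('a \<Rightarrow> complex) \<Rightarrow> 'a \<Rightarrow> complex" where
  "star f = (\<lambda>x. if x \<in> arrows G then f (iv x) else 0)"

lemma convolution_outside [simp]: "x \<notin> arrows G \<Longrightarrow> convolution G f g x = 0"
  unfolding convolution_def
  by (rule sum.neutral) (auto simp: composable_iff)

lemma star_star: "(\<And>x. x \<notin> arrows G \<Longrightarrow> f x = 0) \<Longrightarrow> star (star f) = f"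
  by (auto simp: star_def fun_eq_iff)

text \<open>Inverting and swapping the factors is a bijection between the factorisations of
  \<open>iv x\<close> and those of \<open>x\<close>.\<close>

lemma star_convolution: "star (convolution G f g) = convolution G (star g) (star f)"
proof
  fix x
  show "star (convolution G f g) x = convolution G (star g) (star f) x"
  proof (cases "x \<in> arrows G")
    case True
    have j: "(iv c, iv b) \<in> composable G \<and> iv c \<cdot> iv b = iv y"
      if "(b, c) \<in> composable G" "b \<cdot> c = y" for b c y
      using that iv_mult[of b c] by (simp add: composable_iff)
    have "convolution G f g (iv x) = convolution G (star g) (star f) x"
      unfolding convolution_def
    proof (rule sum.reindex_bij_witness[where i = "\<lambda>(b, c). (iv c, iv b)" and j = "\<lambda>(b, c). (iv c, iv b)"],
        goal_cases)
      case (2 p)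
      then show ?case
        using j[of "fst p" "snd p" "iv x"] True by (auto simp: star_def composable_iff)
    next
      case (4 p)
      then show ?case
        using j[of "fst p" "snd p" x] by (auto simp: star_def composable_iff)
    qed (auto simp: star_def composable_iff)
    then show ?thesis using True by (simp add: star_def[of "convolution _ _ _"])
  qed (simp add: star_def)
qed

text \<open>A factorisation of \<open>x\<close> is determined by its left factor \<open>b\<close>,
  any arrow with the range of \<open>x\<close>. Allowing a larger finite index set \<open>A\<close>
  lets several functions share one sum.\<close>

lemma convolution_eq_sum:
  assumes "x \<in> arrows G" "finite A" "A \<subseteq> {b \<in> arrows G. rng b = rng x}"
    and "\<And>b. b \<in> arrows G \<Longrightarrow> rng b = rng x \<Longrightarrow> f b \<noteq> 0 \<Longrightarrow> b \<in> A"
  shows "convolution G f g x = (\<Sum>b\<in>A. f b * g (iv b \<cdot> x))"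
proof -
  have A: "b \<in> arrows G" "rng b = rng x" if "b \<in> A" for b using assms that by auto
  have "convolution G f g x = (\<Sum>b\<in>{b \<in> A. f b * g (iv b \<cdot> x) \<noteq> 0}. f b * g (iv b \<cdot> x))"
    unfolding convolution_def
  proof (rule sum.reindex_bij_witness[where j = fst and i = "\<lambda>b. (b, iv b \<cdot> x)"], goal_cases)
    case (2 p)
    then show ?case using assms(4)[of "fst p"] by (auto simp: composable_iff)
  next
    case (4 b)
    then show ?case using A[of b] assms(1) by (auto simp: composable_iff)
  qed (auto simp: composable_iff)
  also have "\<dots> = (\<Sum>b\<in>A. f b * g (iv b \<cdot> x))"
    by (rule sum.mono_neutral_left) (use assms in auto)
  finally show ?thesis .
qed

text \<open>A bisection has only one arrow with the range of \<open>x\<close>, so the sum collapses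
  to one term.\<close>

lemma convolution_bisection:
  assumes U: "bisection G U" "\<And>y. y \<notin> U \<Longrightarrow> f y = 0" and b: "b \<in> U" "rng b = rng x"
    and x: "x \<in> arrows G"
  shows "convolution G f g x = f b * g (iv b \<cdot> x)"
proof -
  have "convolution G f g x = (\<Sum>b\<in>{b}. f b * g (iv b \<cdot> x))"
  proof (rule convolution_eq_sum[OF x])
    fix c assume "c \<in> arrows G" "rng c = rng x" "f c \<noteq> 0"
    then have "c \<in> U" using U(2) by blast
    then show "c \<in> {b}" using U(1) b \<open>rng c = rng x\<close> by (auto simp: bisection_def inj_on_def)
  qed (use U b in \<open>auto simp: bisection_def\<close>)
  then show ?thesis by simp
qed

lemma convolution_bisection_zero:
  assumes "\<And>y. y \<notin> U \<Longrightarrow> f y = 0" and "rng x \<notin> rng ` U"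
  shows "convolution G f g x = 0"
proof (cases "x \<in> arrows G")
  case True
  have "convolution G f g x = (\<Sum>b\<in>{}. f b * g (iv b \<cdot> x))"
  proof (rule convolution_eq_sum[OF True])
    show "b \<in> {}" if "rng b = rng x" "f b \<noteq> 0" for b
      using assms that by (metis imageI)
  qed auto
  then show ?thesis by simp
qed simp

lemma convolution_units_left:
  assumes "\<And>y. y \<notin> units G \<Longrightarrow> h y = 0" and "x \<in> arrows G"
  shows "convolution G h f x = h (rng x) * f x"
  using convolution_bisection[of "units G" h "rng x" x f, OF bisection_units[OF subset_refl] assms(1)] assms(2)
  by simp

lemma convolution_units_right:
  assumes "\<And>y. y \<notin> units G \<Longrightarrow> h y = 0" and x: "x \<in> arrows G"
  shows "convolution G f h x = f x * h (src x)"
proof -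
  have h: "star h y = 0" if "y \<notin> units G" for y
  proof -
    have "iv y \<notin> units G" if "y \<in> arrows G"
      using that \<open>y \<notin> units G\<close> by (metis inverse_inverse iv_unit)
    then show ?thesis using assms(1)[of "iv y"] by (simp add: star_def)
  qed
  have "convolution G f h x = star (star (convolution G f h)) x"
    by (subst star_star) auto
  also have "\<dots> = convolution G (star h) (star f) (iv x)"
    using x by (subst star_convolution) (simp add: star_def[of "convolution _ _ _"])
  also have "\<dots> = f x * h (src x)"
    using x by (subst convolution_units_left[OF h]) (simp_all add: star_def)
  finally show ?thesis .
qed

text \<open>The finiteness that makes convolution additive: a sum over an infinite index set is 0 by
  convention, so additivity has to be argued on finite ones.\<close>

definition fibre_finite :: "('a \<Rightarrow> complex) \<Rightarrow> bool" where
  "fibre_finite f \<longleftrightarrow> (\<forall>u. finite {b \<in> arrows G. rng b = u \<and> f b \<noteq> 0})"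

lemma fibre_finite_add:
  assumes "fibre_finite f" "fibre_finite g" shows "fibre_finite (f + g)"
  unfolding fibre_finite_def
proof
  fix u
  have "{b \<in> arrows G. rng b = u \<and> (f + g) b \<noteq> 0} \<subseteq>
      {b \<in> arrows G. rng b = u \<and> f b \<noteq> 0} \<union> {b \<in> arrows G. rng b = u \<and> g b \<noteq> 0}" by auto
  then show "finite {b \<in> arrows G. rng b = u \<and> (f + g) b \<noteq> 0}"
    using assms by (metis (no_types, lifting) fibre_finite_def finite_Un finite_subset)
qed

lemma fibre_finite_bisection:
  assumes "bisection G U" "\<And>y. y \<notin> U \<Longrightarrow> f y = 0" shows "fibre_finite f"
  unfolding fibre_finite_def
proof
  fix u
  have "inj_on rng {b \<in> arrows G. rng b = u \<and> f b \<noteq> 0}"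
    using assms by (auto simp: bisection_def inj_on_def) metis
  moreover have "rng ` {b \<in> arrows G. rng b = u \<and> f b \<noteq> 0} \<subseteq> {u}" by auto
  ultimately show "finite {b \<in> arrows G. rng b = u \<and> f b \<noteq> 0}"
    by (meson finite.intros finite_imageD finite_subset)
qed

lemma convolution_add_left:
  assumes "fibre_finite f" "fibre_finite f'"
  shows "convolution G (f + f') g = convolution G f g + convolution G f' g"
proof
  fix x
  show "convolution G (f + f') g x = (convolution G f g + convolution G f' g) x"
  proof (cases "x \<in> arrows G")
    case True
    \<comment> \<open>One index set for all three functions, because the support of
      \<open>f + f'\<close> may shrink by cancellation.\<close>
    define A where "A = {b \<in> arrows G. rng b = rng x \<and> f b \<noteq> 0} \<union>
      {b \<in> arrows G. rng b = rng x \<and> f' b \<noteq> 0}"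
    have "finite A" using assms by (simp add: A_def fibre_finite_def)
    then have "convolution G h g x = (\<Sum>b\<in>A. h b * g (iv b \<cdot> x))" if "h \<in> {f, f', f + f'}" for h
      by (intro convolution_eq_sum) (use True that in \<open>auto simp: A_def\<close>)
    then show ?thesis by (simp add: sum.distrib[symmetric] distrib_right)
  qed simp
qed

end


section \<open>Compact open bisections\<close>

lemma continuous_map_complex_mult:
  fixes f g :: "'a \<Rightarrow> complex"
  assumes "continuous_map Y euclidean f" "continuous_map Y euclidean g"
  shows "continuous_map Y euclidean (\<lambda>x. f x * g x)"
  using assms by (simp add: continuous_map_atin tendsto_mult)

lemma continuous_map_complex_inverse:
  fixes f :: "'a \<Rightarrow> complex"
  assumes "continuous_map Y euclidean f" "\<And>x. x \<in> topspace Y \<Longrightarrow> f x \<noteq> 0"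
  shows "continuous_map Y euclidean (\<lambda>x. inverse (f x))"
  using assms by (simp add: continuous_map_atin tendsto_inverse)

context ample_groupoid
begin

abbreviation X :: "'a topology" where "X \<equiv> arrow_topology G"

lemma continuous_map_mult:
  assumes "continuous_map Y X f" "continuous_map Y X g"
    and "\<And>y. y \<in> topspace Y \<Longrightarrow> src (f y) = rng (g y)"
  shows "continuous_map Y X (\<lambda>y. f y \<cdot> g y)"
proof -
  have "f y \<in> arrows G" "g y \<in> arrows G" if "y \<in> topspace Y" for y
    using assms(1,2) that topspace_arrow_topology by (auto simp: continuous_map_def Pi_iff)
  then have "continuous_map Y (subtopology (prod_topology X X) (composable G)) (\<lambda>y. (f y, g y))"
    using assms by (intro continuous_map_into_subtopology continuous_map_pairedI)
      (auto simp: composable_iff)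
  from continuous_map_compose[OF this continuous_mult] show ?thesis by (simp add: o_def)
qed

lemma continuous_rng: "continuous_map X X rng"
  unfolding range_map_def
  by (rule continuous_map_mult) (use continuous_inverse topspace_arrow_topology in auto)

lemma continuous_src: "continuous_map X X src"
  unfolding source_def
  by (rule continuous_map_mult) (use continuous_inverse topspace_arrow_topology in auto)

lemma openin_subset_arrows: "openin X U \<Longrightarrow> U \<subseteq> arrows G"
  using openin_subset topspace_arrow_topology by metis

lemma compactin_subset_arrows: "compactin X K \<Longrightarrow> K \<subseteq> arrows G"
  using compactin_subset_topspace topspace_arrow_topology by metis

lemma openin_preimage:
  assumes "openin X U" "openin X V"
  shows "openin X {x \<in> U. rng x \<in> V}" "openin X {x \<in> U. src x \<in> V}"
  using openin_continuous_map_preimage_gen assms continuous_rng continuous_src by blast+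

lemma rng_locally_homeomorphic:
  assumes "x \<in> arrows G"
  obtains N where "openin X N" "x \<in> N" "openin (unit_space G) (rng ` N)"
    "homeomorphic_map (subtopology X N) (subtopology (unit_space G) (rng ` N)) rng" "inj_on rng N"
proof -
  obtain N where N: "openin X N" "x \<in> N" "openin (unit_space G) (rng ` N)"
    "homeomorphic_map (subtopology X N) (subtopology (unit_space G) (rng ` N)) rng"
    using range_local_homeomorphism assms topspace_arrow_topology
    unfolding local_homeomorphism_def by metis
  moreover have "inj_on rng N"
    using homeomorphic_imp_injective_map[OF N(4)] openin_subset[OF N(1)]
    by (simp add: inf.absorb2)
  ultimately show ?thesis using that by blast
qed

text \<open>The unit space is open because near a unit the range map is injective and fixes units.\<close>

lemma openin_units: "openin X (units G)"
proof (subst openin_subopen, intro ballI)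
  fix u assume u: "u \<in> units G"
  obtain N where N: "openin X N" "u \<in> N" "inj_on rng N"
    using rng_locally_homeomorphic u by (metis units_arrow)
  let ?T = "{x \<in> N. rng x \<in> N}"
  have "x \<in> units G" if "x \<in> ?T" for x
  proof -
    have "x \<in> arrows G" using that openin_subset_arrows[OF N(1)] by auto
    moreover have "rng x = x" using inj_onD[OF N(3), of "rng x" x] that \<open>x \<in> arrows G\<close> by simp
    ultimately show ?thesis using units_iff by blast
  qed
  then show "\<exists>T. openin X T \<and> u \<in> T \<and> T \<subseteq> units G"
    using openin_preimage(1)[OF N(1) N(1)] N(2) u by (intro exI[of _ ?T]) auto
qed

lemma openin_unit_space: "openin (unit_space G) U \<longleftrightarrow> openin X U \<and> U \<subseteq> units G"
  unfolding unit_space_def by (rule openin_open_subtopology[OF openin_units])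

lemma openin_rng_image:
  assumes U: "openin X U" shows "openin X (rng ` U)"
proof (subst openin_subopen, intro ballI)
  fix y assume "y \<in> rng ` U"
  then obtain x where x: "x \<in> U" "y = rng x" by blast
  then have "x \<in> arrows G" using openin_subset_arrows[OF U] by auto
  then obtain N where N: "openin X N" "x \<in> N" "openin (unit_space G) (rng ` N)"
    "homeomorphic_map (subtopology X N) (subtopology (unit_space G) (rng ` N)) rng"
    using rng_locally_homeomorphic by metis
  have "openin (subtopology X N) (U \<inter> N)" using U by (simp add: openin_subtopology_Int)
  then have "openin (subtopology (unit_space G) (rng ` N)) (rng ` (U \<inter> N))"
    using homeomorphic_imp_open_map[OF N(4)] by (simp add: open_map_def)
  then have "openin X (rng ` (U \<inter> N))"
    using N(3) by (simp add: openin_open_subtopology openin_unit_space)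
  then show "\<exists>T. openin X T \<and> y \<in> T \<and> T \<subseteq> rng ` U"
    using x N(2) by (intro exI[of _ "rng ` (U \<inter> N)"]) auto
qed

lemma iv_image_eq: "U \<subseteq> arrows G \<Longrightarrow> iv ` U = {x \<in> arrows G. iv x \<in> U}"
  by (auto simp: image_iff) (metis inverse_inverse)

lemma openin_iv_image: "openin X U \<Longrightarrow> openin X (iv ` U)"
  using openin_continuous_map_preimage[OF continuous_inverse, of U]
  by (simp add: iv_image_eq openin_subset_arrows topspace_arrow_topology)

lemma rng_iv_image: "U \<subseteq> arrows G \<Longrightarrow> rng ` iv ` U = src ` U"
  by (force simp: image_image)

lemma src_iv_image: "U \<subseteq> arrows G \<Longrightarrow> src ` iv ` U = rng ` U"
  by (force simp: image_image)

definition compact_open_bisection :: "'a set \<Rightarrow> bool" where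
  "compact_open_bisection U \<longleftrightarrow> openin X U \<and> compactin X U \<and> bisection G U"

lemma compact_open_bisectionD:
  assumes "compact_open_bisection U"
  shows "openin X U" "compactin X U" "bisection G U" "U \<subseteq> arrows G"
  using assms openin_subset_arrows by (auto simp: compact_open_bisection_def)

lemma compact_open_bisection_iv:
  "compact_open_bisection U \<Longrightarrow> compact_open_bisection (iv ` U)"
  by (simp add: compact_open_bisection_def openin_iv_image bisection_iv
      image_compactin[OF _ continuous_inverse])

lemma compact_open_in_units:
  assumes "openin X V" "V \<subseteq> units G" "u \<in> V"
  obtains W where "compact_open_bisection W" "u \<in> W" "W \<subseteq> V"
proof -
  obtain \<B> where B: "\<And>K. K \<in> \<B> \<Longrightarrow> openin (unit_space G) K \<and> compact_hausdorff_in (unit_space G) K"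
    "openin (unit_space G) = arbitrary union_of (\<lambda>K. K \<in> \<B>)"
    using compact_open_basis by blast
  have "(arbitrary union_of (\<lambda>K. K \<in> \<B>)) V"
    using assms B(2) openin_unit_space by metis
  then obtain K where K: "K \<in> \<B>" "u \<in> K" "K \<subseteq> V"
    using assms(3) by (auto simp: union_of_def)
  then have "openin X K" "compactin X K"
    using B(1)[OF K(1)] openin_unit_space
    by (auto simp: compact_hausdorff_in_def unit_space_def compactin_subtopology)
  moreover have "bisection G K" using K(3) assms(2) by (intro bisection_units) auto
  ultimately show ?thesis using that K by (simp add: compact_open_bisection_def)
qed

text \<open>Intersecting a chart at \<open>x\<close> with the inverse of a chart at
  \<open>iv x\<close> makes range and source injective; a compact open set of units is then pulled
  back along the range map.\<close>

lemma compact_open_bisection_basis: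
  assumes Q: "openin X Q" "x \<in> Q"
  obtains B where "compact_open_bisection B" "x \<in> B" "B \<subseteq> Q"
proof -
  have x: "x \<in> arrows G" using Q openin_subset_arrows by auto
  obtain N where N: "openin X N" "x \<in> N" "openin (unit_space G) (rng ` N)"
    "homeomorphic_map (subtopology X N) (subtopology (unit_space G) (rng ` N)) rng" "inj_on rng N"
    using rng_locally_homeomorphic[OF x] by metis
  obtain M where M: "openin X M" "iv x \<in> M" "inj_on rng M"
    using rng_locally_homeomorphic[OF inverse_closed[OF x]] by metis
  have Ms: "M \<subseteq> arrows G" using openin_subset_arrows[OF M(1)] .
  have Ns: "N \<subseteq> arrows G" using openin_subset_arrows[OF N(1)] .
  define U where "U = N \<inter> iv ` M \<inter> Q"
  have U1: "openin X U"
    unfolding U_def by (intro openin_Int N(1) Q(1) openin_iv_image[OF M(1)])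
  have U2: "x \<in> U" "U \<subseteq> N"
    unfolding U_def iv_image_eq[OF Ms] using N(2) M(2) Q(2) x by simp_all blast
  note U = U1 U2
  have "inj_on src (iv ` M)"
    using M(3) Ms by (auto simp: inj_on_def subset_iff)
  then have "inj_on src U" by (rule inj_on_subset) (auto simp: U_def)
  moreover have "inj_on rng U" using N(5) U(3) by (rule inj_on_subset)
  ultimately have bU: "bisection G U"
    using U(3) Ns by (auto simp: bisection_def)
  obtain W where W: "compact_open_bisection W" "rng x \<in> W" "W \<subseteq> rng ` U"
  proof (rule compact_open_in_units[of "rng ` U" "rng x"])
    show "openin X (rng ` U)" by (rule openin_rng_image[OF U(1)])
    show "rng ` U \<subseteq> units G" using U(3) Ns by auto
  qed (use U in auto)
  \<comment> \<open>The range map is a homeomorphism on \<open>N\<close> and carries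
    \<open>B\<close> onto \<open>W\<close>, so compactness of \<open>W\<close> passes to
    \<open>B\<close>.\<close>
  define B where "B = {y \<in> U. rng y \<in> W}"
  have "rng ` B = W" using W(3) by (auto simp: B_def)
  have "W \<subseteq> rng ` N" using W(3) U(3) by blast
  moreover from this have "W \<subseteq> units G" using Ns by (force simp: subset_iff)
  ultimately have "compactin (subtopology (unit_space G) (rng ` N)) W"
    unfolding unit_space_def compactin_subtopology
    using compact_open_bisectionD(2)[OF W(1)] by simp
  then have "compactin (subtopology X N) B"
    using homeomorphic_map_compactness[OF N(4), of B] openin_subset[OF N(1)] U(3) \<open>rng ` B = W\<close>
    by (auto simp: B_def)
  then have "compactin X B" by (simp add: compactin_subtopology)
  moreover have "openin X B"
    unfolding B_def by (intro openin_preimage U(1) compact_open_bisectionD(1)[OF W(1)])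
  moreover have "bisection G B" by (rule bisection_subset[OF bU]) (auto simp: B_def)
  ultimately show ?thesis
    using U(2) W(2) by (intro that[of B]) (auto simp: B_def U_def compact_open_bisection_def)
qed

end

section \<open>The Hausdorff case: compact open bisections and units are clopen\<close>

locale hausdorff_ample_groupoid = ample_groupoid +
  assumes Hausdorff_arrows: "Hausdorff_space (arrow_topology G)"
begin

lemma closedin_compact_open_bisection: "compact_open_bisection U \<Longrightarrow> closedin X U"
  by (rule compactin_imp_closedin[OF Hausdorff_arrows compact_open_bisectionD(2)])

text \<open>The units are the fixed points of the continuous range map, and in a Hausdorff space an
  equaliser is closed.\<close>

lemma closedin_units: "closedin X (units G)"
proof -
  have u: "units G = {x \<in> topspace X. rng x = x}"
    unfolding topspace_arrow_topology using units_iff by blast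
  show ?thesis
    unfolding u by (rule closedin_continuous_maps_eq[OF Hausdorff_arrows continuous_rng]) simp
qed

lemma compact_open_bisection_rng_image:
  assumes "compact_open_bisection U" shows "compact_open_bisection (rng ` U)"
  unfolding compact_open_bisection_def
proof (intro conjI bisection_units)
  note U = compact_open_bisectionD[OF assms]
  show "openin X (rng ` U)" by (rule openin_rng_image[OF U(1)])
  show "compactin X (rng ` U)" by (rule image_compactin[OF U(2) continuous_rng])
  show "rng ` U \<subseteq> units G" using U(4) by auto
qed

lemma continuous_map_vanishing_off_clopen:
  fixes f :: "'a \<Rightarrow> complex"
  assumes "openin X S" "closedin X S" "continuous_map (subtopology X S) euclidean f"
    and "\<And>x. x \<in> topspace X \<Longrightarrow> x \<notin> S \<Longrightarrow> f x = 0"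
  shows "continuous_map X euclidean f"
proof -
  let ?T = "\<lambda>b. if b then S else topspace X - S"
  let ?f = "\<lambda>b. if b then f else (\<lambda>_. 0)"
  have "openin X (topspace X - S)" using assms(2) by blast
  then have 1: "openin X (?T b)" for b using assms(1) by simp
  have 2: "continuous_map (subtopology X (?T b)) euclidean (?f b)" for b
    using assms(3) by (cases b) simp_all
  have 3: "?f i x = ?f j x" if "x \<in> topspace X \<inter> ?T i \<inter> ?T j" for i j x
    using that by (cases i; cases j) simp_all
  have 4: "\<exists>j. j \<in> UNIV \<and> x \<in> ?T j \<and> f x = ?f j x" if "x \<in> topspace X" for x
    using that assms(4) by (intro exI[of _ "x \<in> S"]) simp
  show ?thesis
    by (rule pasting_lemma[where I = UNIV and T = ?T and f = ?f]) (assumption | rule 1 2 3 4)+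
qed

lemma continuous_map_restrict_clopen:
  fixes f :: "'a \<Rightarrow> complex"
  assumes "openin X S" "closedin X S" "continuous_map (subtopology X S) euclidean f"
  shows "continuous_map X euclidean (\<lambda>x. if x \<in> S then f x else 0)"
proof (rule continuous_map_vanishing_off_clopen[OF assms(1,2)])
  show "continuous_map (subtopology X S) euclidean (\<lambda>x. if x \<in> S then f x else 0)"
    by (rule continuous_map_eq[OF assms(3)]) simp
qed simp


section \<open>Functions of compact support\<close>

text \<open>For a bisection \<open>U\<close>, \<open>local_section U\<close> inverts the source map on \<open>U\<close>, and
  \<open>translate U\<close> is the partial homeomorphism \<open>x \<mapsto> U x\<close>.\<close>

definition local_section :: "'a set \<Rightarrow> 'a \<Rightarrow> 'a" where
  "local_section U = inv_into U src"

definition translate :: "'a set \<Rightarrow> 'a \<Rightarrow> 'a" where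
  "translate U x = local_section U (rng x) \<cdot> x"

lemma local_section_src [simp]:
  "bisection G U \<Longrightarrow> b \<in> U \<Longrightarrow> local_section U (src b) = b"
  by (simp add: local_section_def bisection_def inv_into_f_f)

lemma translate_eq: "bisection G U \<Longrightarrow> b \<in> U \<Longrightarrow> rng x = src b \<Longrightarrow> translate U x = b \<cdot> x"
  by (simp add: translate_def)

text \<open>A continuous bijection from a compact space onto a Hausdorff space is a homeomorphism;
  this is applied to the source map on \<open>U\<close>.\<close>

lemma continuous_local_section:
  assumes U: "compact_open_bisection U"
  shows "continuous_map (subtopology X (src ` U)) X (local_section U)"
proof -
  note D = compact_open_bisectionD[OF U]
  have tU: "topspace (subtopology X U) = U" "topspace (subtopology X (src ` U)) = src ` U"
    using D(4) by (auto simp: topspace_arrow_topology)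
  have "homeomorphic_map (subtopology X U) (subtopology X (src ` U)) src"
  proof (rule continuous_imp_homeomorphic_map)
    show "continuous_map (subtopology X U) (subtopology X (src ` U)) src"
      by (intro continuous_map_into_subtopology continuous_map_from_subtopology[OF continuous_src])
        (simp add: tU)
    show "compact_space (subtopology X U)" by (rule compact_space_subtopology[OF D(2)])
    show "Hausdorff_space (subtopology X (src ` U))"
      by (rule Hausdorff_space_subtopology[OF Hausdorff_arrows])
    show "inj_on src (topspace (subtopology X U))"
      unfolding tU using D(3) by (simp add: bisection_def)
  qed (simp only: tU)
  then obtain g where g: "homeomorphic_maps (subtopology X U) (subtopology X (src ` U)) src g"
    using homeomorphic_map_maps by blast
  have "continuous_map (subtopology X (src ` U)) X g"
    using g by (simp add: homeomorphic_maps_def continuous_map_in_subtopology)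
  moreover have "g u = local_section U u" if u: "u \<in> src ` U" for u
  proof -
    obtain b where "b \<in> U" "u = src b" using u by blast
    moreover have "g (src b) = b" using g \<open>b \<in> U\<close> unfolding homeomorphic_maps_def tU by blast
    ultimately show ?thesis using D(3) by simp
  qed
  ultimately show ?thesis by (rule continuous_map_eq) (simp add: tU)
qed

lemma continuous_translate:
  assumes U: "compact_open_bisection U"
  shows "continuous_map (subtopology X {x \<in> arrows G. rng x \<in> src ` U}) X (translate U)"
    (is "continuous_map ?Y X _")
proof -
  note D = compact_open_bisectionD[OF U]
  have tY: "topspace ?Y = {x \<in> arrows G. rng x \<in> src ` U}"
    by (auto simp: topspace_arrow_topology)
  have "continuous_map ?Y (subtopology X (src ` U)) rng"
    by (intro continuous_map_into_subtopology continuous_map_from_subtopology[OF continuous_rng])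
      (simp add: tY)
  from continuous_map_compose[OF this continuous_local_section[OF U]]
  have "continuous_map ?Y X (\<lambda>x. local_section U (rng x))" by (simp only: o_def)
  moreover have "src (local_section U (rng x)) = rng x" if "x \<in> topspace ?Y" for x
    using that D(3) unfolding tY by auto
  moreover have "continuous_map ?Y X (\<lambda>x. x)"
    by (rule continuous_map_from_subtopology[OF continuous_map_id[unfolded id_def]])
  ultimately show ?thesis
    unfolding translate_def[abs_def] by (intro continuous_map_mult)
qed

text \<open>Since \<open>U\<close> is clopen, extension by zero preserves continuity, so continuity
  on \<open>U\<close> can be replaced by continuity on all arrows.\<close>

lemma Cc_generators_iff:
  "f \<in> Cc_generators G \<longleftrightarrow>
     (\<exists>U. compact_open_bisection U \<and> (\<forall>x. x \<notin> U \<longrightarrow> f x = 0) \<and> continuous_map X euclidean f)"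
  (is "?L \<longleftrightarrow> ?R")
proof
  assume ?L
  then obtain U where U: "openin X U" "compactin X U" "bisection G U" "\<And>x. x \<notin> U \<Longrightarrow> f x = 0"
    "continuous_map (subtopology X U) euclidean f"
    by (auto simp: Cc_generators_def compact_hausdorff_in_def)
  then have "compact_open_bisection U" by (simp add: compact_open_bisection_def)
  moreover have "continuous_map X euclidean f"
    by (rule continuous_map_vanishing_off_clopen[OF U(1) _ U(5)])
      (use U(4) calculation closedin_compact_open_bisection in auto)
  ultimately show ?R using U(4) by blast
next
  assume ?R
  then obtain U where U: "compact_open_bisection U" "\<forall>x. x \<notin> U \<longrightarrow> f x = 0"
    "continuous_map X euclidean f" by blast
  show ?L
    unfolding Cc_generators_def compact_hausdorff_in_def
    by (intro CollectI exI[of _ U] conjI compact_open_bisectionD[OF U(1)] U(2)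
        Hausdorff_space_subtopology[OF Hausdorff_arrows] continuous_map_from_subtopology[OF U(3)])
qed

lemma Cc_generators_scale:
  "f \<in> Cc_generators G \<Longrightarrow> (\<lambda>x. c * f x) \<in> Cc_generators G"
  unfolding Cc_generators_iff
  by (auto intro!: continuous_map_complex_mult)

lemma indicator_in_Cc_generators:
  assumes "compact_open_bisection U"
  shows "indicator U \<in> Cc_generators G"
  unfolding Cc_generators_def
proof (intro CollectI exI conjI)
  show "continuous_map (subtopology X U) euclidean (indicator U :: 'a \<Rightarrow> complex)"
    by (rule continuous_map_eq[of _ _ "\<lambda>_. 1"]) auto
qed (use assms Hausdorff_space_subtopology[OF Hausdorff_arrows] in
    \<open>auto simp: compact_open_bisection_def compact_hausdorff_in_def\<close>)

lemma Cc_generators_subset: "Cc_generators G \<subseteq> Cc G"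
  unfolding Cc_def by (rule cfun.span_superset)

lemma Cc_add: "f \<in> Cc G \<Longrightarrow> g \<in> Cc G \<Longrightarrow> f + g \<in> Cc G"
  unfolding Cc_def by (rule cfun.span_add)

text \<open>Generators are closed under scalars, so the span is already reached by adding
  generators.\<close>

lemma Cc_induct [consumes 1, case_names zero add]:
  assumes "f \<in> Cc G" "P 0"
    and "\<And>f g. f \<in> Cc_generators G \<Longrightarrow> g \<in> Cc G \<Longrightarrow> P g \<Longrightarrow> P (f + g)"
  shows "P f"
proof -
  have "f \<in> Cc G \<and> P f"
    using assms(1) unfolding Cc_def
  proof (induction rule: cfun.span_induct_alt)
    case base
    show ?case using assms(2) cfun.span_zero by blast
  next
    case (step c x y)
    have "(\<lambda>z. c * x z) \<in> Cc_generators G" using step(1) by (rule Cc_generators_scale)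
    then show ?case
      using step(2) assms(3) Cc_add Cc_generators_subset unfolding Cc_def by blast
  qed
  then show ?thesis ..
qed

text \<open>The bisections may overlap: the part of \<open>f\<close> on the clopen set
  \<open>B\<close> is split off as a generator, and the remainder vanishes on \<open>B\<close> and
  outside the other bisections.\<close>

lemma Cc_clopen_cover:
  assumes "finite F" "\<And>B. B \<in> F \<Longrightarrow> compact_open_bisection B"
    and "continuous_map X euclidean f" "\<And>x. x \<notin> \<Union>F \<Longrightarrow> f x = 0"
  shows "f \<in> Cc G"
  using assms
proof (induction F arbitrary: f rule: finite_induct)
  case empty
  then have "f = 0" by auto
  then show ?case unfolding Cc_def by (simp only: cfun.span_zero)
next
  case (insert B F)
  define g where "g = (\<lambda>x. if x \<in> B then f x else 0)"
  have B: "compact_open_bisection B" using insert.prems(1) by simp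
  have g: "continuous_map X euclidean g"
    unfolding g_def
    by (rule continuous_map_restrict_clopen[OF compact_open_bisectionD(1)[OF B]
          closedin_compact_open_bisection[OF B] continuous_map_from_subtopology[OF insert.prems(2)]])
  have "g \<in> Cc_generators G" using B g by (auto simp: Cc_generators_iff g_def)
  moreover have "(\<lambda>x. f x - g x) \<in> Cc G"
  proof (rule insert.IH)
    show "continuous_map X euclidean (\<lambda>x. f x - g x)"
      using insert.prems(2) g by (rule continuous_map_diff)
    show "f x - g x = 0" if "x \<notin> \<Union>F" for x
      using that insert.prems(3) by (auto simp: g_def)
  qed (use insert.prems in auto)
  moreover have "f = g + (\<lambda>x. f x - g x)" by auto
  ultimately show ?case using Cc_add Cc_generators_subset by (metis subsetD)
qed

text \<open>For the converse, finitely many compact open bisections cover \<open>K\<close>. This is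
  the criterion by which involutions and products are later placed in \<open>Cc G\<close>.\<close>

lemma Cc_iff:
  "f \<in> Cc G \<longleftrightarrow>
     continuous_map X euclidean f \<and> (\<exists>K. compactin X K \<and> (\<forall>x. x \<notin> K \<longrightarrow> f x = 0))"
  (is "?L \<longleftrightarrow> ?R")
proof
  assume ?L
  then show ?R
  proof (induction rule: Cc_induct)
    case zero
    show ?case by (auto simp: zero_fun_def intro: exI[of _ "{}"])
  next
    case (add f g)
    obtain U where U: "compactin X U" "\<And>x. x \<notin> U \<Longrightarrow> f x = 0" "continuous_map X euclidean f"
      using add(1) by (auto simp: Cc_generators_iff compact_open_bisection_def)
    obtain K where K: "compactin X K" "\<And>x. x \<notin> K \<Longrightarrow> g x = 0" "continuous_map X euclidean g"
      using add(3) by blast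
    have "continuous_map X euclidean (f + g)"
      unfolding plus_fun_def using U(3) K(3) by (rule continuous_map_add)
    moreover have "\<forall>x. x \<notin> U \<union> K \<longrightarrow> (f + g) x = 0" using U(2) K(2) by simp
    ultimately show ?case using compactin_Un[OF U(1) K(1)] by blast
  qed
next
  assume ?R
  then obtain K where K: "compactin X K" "\<And>x. x \<notin> K \<Longrightarrow> f x = 0" by blast
  have "K \<subseteq> \<Union>{B. compact_open_bisection B}"
  proof
    fix x assume "x \<in> K"
    then have "x \<in> topspace X" using compactin_subset_topspace[OF K(1)] by blast
    then show "x \<in> \<Union>{B. compact_open_bisection B}"
      using compact_open_bisection_basis[OF openin_topspace] by (metis UnionI mem_Collect_eq)
  qed
  then obtain F where F: "finite F" "F \<subseteq> {B. compact_open_bisection B}" "K \<subseteq> \<Union>F"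
    using compactinD[OF K(1), of "{B. compact_open_bisection B}"]
    by (auto simp: compact_open_bisection_def)
  show ?L
  proof (rule Cc_clopen_cover[OF F(1)])
    show "f x = 0" if "x \<notin> \<Union>F" for x using that F(3) K(2) by blast
  qed (use F(2) \<open>?R\<close> in auto)
qed

lemma Cc_outside: "f \<in> Cc G \<Longrightarrow> x \<notin> arrows G \<Longrightarrow> f x = 0"
  using compactin_subset_arrows by (auto simp: Cc_iff)

lemma Cc_star:
  assumes "f \<in> Cc G" shows "star f \<in> Cc G"
proof -
  obtain K where f: "continuous_map X euclidean f" and K: "compactin X K" "\<And>x. x \<notin> K \<Longrightarrow> f x = 0"
    using assms by (auto simp: Cc_iff)
  have "continuous_map X euclidean (star f)"
    by (rule continuous_map_eq[OF continuous_map_compose[OF continuous_inverse f]])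
      (simp add: star_def topspace_arrow_topology)
  moreover have "star f x = 0" if "x \<notin> iv ` K" for x
    using that K(2)[of "iv x"] by (auto simp: star_def) (metis imageI inverse_inverse)
  ultimately show ?thesis
    using image_compactin[OF K(1) continuous_inverse] by (auto simp: Cc_iff)
qed

lemma Cc_fibre_finite: "f \<in> Cc G \<Longrightarrow> fibre_finite f"
proof (induction rule: Cc_induct)
  case zero
  then show ?case by (simp add: fibre_finite_def)
next
  case (add f g)
  have "fibre_finite f"
    using add(1) fibre_finite_bisection by (auto simp: Cc_generators_iff compact_open_bisection_def)
  then show ?case using add(3) by (rule fibre_finite_add)
qed

text \<open>The value at \<open>x\<close> is \<open>g b * f (iv b \<cdot> x)\<close> for the unique
  \<open>b\<close> in \<open>U\<close> with the range of \<open>x\<close>. Continuity holds because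
  \<open>b\<close> depends continuously on \<open>x\<close>; the support lies in the translate by
  \<open>U\<close> of a compact set.\<close>

lemma convolution_generator_Cc:
  assumes g: "g \<in> Cc_generators G" and f: "f \<in> Cc G"
  shows "convolution G g f \<in> Cc G"
proof -
  obtain U where U: "compact_open_bisection U" and g0: "\<And>x. x \<notin> U \<Longrightarrow> g x = 0"
    and gc: "continuous_map X euclidean g"
    using g by (auto simp: Cc_generators_iff)
  obtain K where fc: "continuous_map X euclidean f" and K: "compactin X K" "\<And>x. x \<notin> K \<Longrightarrow> f x = 0"
    using f by (auto simp: Cc_iff)
  note D = compact_open_bisectionD[OF U]
  \<comment> \<open>Local sections invert the source map, but here \<open>b\<close> must be
    recovered from its range. The section of the inverse bisection returns \<open>iv b\<close>, and
    translation by \<open>V\<close> sends \<open>x\<close> to \<open>iv b \<cdot> x\<close>.\<close>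
  define V where "V = iv ` U"
  have V: "compact_open_bisection V" using U by (simp add: V_def compact_open_bisection_iv)
  have VU: "src ` V = rng ` U" unfolding V_def using D(4) by (rule src_iv_image)
  define R where "R = {x \<in> arrows G. rng x \<in> rng ` U}"
  let ?Y = "subtopology X R"
  have tY: "topspace ?Y = R" by (auto simp: R_def topspace_arrow_topology)
  have rU: "compact_open_bisection (rng ` U)" by (rule compact_open_bisection_rng_image[OF U])
  have Ro: "openin X R"
    using openin_continuous_map_preimage[OF continuous_rng compact_open_bisectionD(1)[OF rU]]
    by (simp add: R_def topspace_arrow_topology)
  have Rc: "closedin X R"
    using closedin_continuous_map_preimage[OF continuous_rng closedin_compact_open_bisection[OF rU]]
    by (simp add: R_def topspace_arrow_topology)
  have conv: "convolution G g f x = g b * f (iv b \<cdot> x)" if "b \<in> U" "rng b = rng x" "x \<in> arrows G" for b x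
    using convolution_bisection[OF D(3) g0 that] .
  have conv_eq: "g (iv (local_section V (rng x))) * f (translate V x) = convolution G g f x"
    if x: "x \<in> R" for x
  proof -
    have "rng x \<in> rng ` U" using x by (simp add: R_def)
    then obtain b where b: "b \<in> U" "rng b = rng x" by (metis imageE)
    have "b \<in> arrows G" using b(1) D(4) by blast
    then have "local_section V (rng x) = iv b"
      using local_section_src[OF compact_open_bisectionD(3)[OF V], of "iv b"] b by (simp add: V_def)
    then show ?thesis using conv[OF b] x \<open>b \<in> arrows G\<close> by (simp add: translate_def R_def)
  qed
  have "continuous_map ?Y X rng" by (rule continuous_map_from_subtopology[OF continuous_rng])
  then have "continuous_map ?Y (subtopology X (src ` V)) rng"
    by (rule continuous_map_into_subtopology) (auto simp: tY VU R_def)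
  then have "continuous_map ?Y X (local_section V \<circ> rng)"
    by (rule continuous_map_compose[OF _ continuous_local_section[OF V]])
  then have 1: "continuous_map ?Y euclidean (g \<circ> (iv \<circ> (local_section V \<circ> rng)))"
    by (intro continuous_map_compose[OF _ gc] continuous_map_compose[OF _ continuous_inverse])
  have 2: "continuous_map ?Y euclidean (f \<circ> translate V)"
    using continuous_map_compose[OF continuous_translate[OF V] fc] by (simp add: VU R_def)
  have "continuous_map ?Y euclidean (convolution G g f)"
    by (rule continuous_map_eq[OF continuous_map_complex_mult[OF 1 2]]) (simp add: tY conv_eq)
  moreover have off: "convolution G g f x = 0" if "x \<notin> R" for x
    using that convolution_bisection_zero[of U g x f, OF g0] by (cases "x \<in> arrows G") (auto simp: R_def)
  ultimately have c: "continuous_map X euclidean (convolution G g f)"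
    by (rule continuous_map_vanishing_off_clopen[OF Ro Rc])
  \<comment> \<open>The domain of translation by \<open>U\<close>. Being closed, it meets
    \<open>K\<close> in a compact set, whose translate contains the support.\<close>
  let ?S = "{x \<in> arrows G. rng x \<in> src ` U}"
  have "compact_open_bisection (src ` U)"
    using compact_open_bisection_rng_image[OF V] rng_iv_image[OF D(4)] by (simp add: V_def)
  then have "closedin X ?S"
    using closedin_continuous_map_preimage[OF continuous_rng closedin_compact_open_bisection]
    by (simp add: topspace_arrow_topology)
  then have "compactin X (?S \<inter> K)" by (rule closed_Int_compactin[OF _ K(1)])
  then have "compactin (subtopology X ?S) (?S \<inter> K)" by (simp add: compactin_subtopology)
  then have "compactin X (translate U ` (?S \<inter> K))"
    by (rule image_compactin[OF _ continuous_translate[OF U]])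
  moreover have "convolution G g f x = 0" if "x \<notin> translate U ` (?S \<inter> K)" for x
  proof (rule ccontr)
    assume nz: "convolution G g f x \<noteq> 0"
    then have "x \<in> R" using off by blast
    then have "x \<in> arrows G" "rng x \<in> rng ` U" by (simp_all add: R_def)
    then obtain b where b: "b \<in> U" "rng b = rng x" "x \<in> arrows G" by (metis imageE)
    have ba: "b \<in> arrows G" using b(1) D(4) by blast
    have "f (iv b \<cdot> x) \<noteq> 0" using nz conv[OF b] by auto
    then have "iv b \<cdot> x \<in> ?S \<inter> K" using K(2) ba b by auto
    moreover have "x = translate U (iv b \<cdot> x)"
      using translate_eq[OF D(3) b(1)] ba b by simp
    ultimately have "x \<in> translate U ` (?S \<inter> K)" by (rule rev_image_eqI)
    with that show False ..
  qed
  ultimately show ?thesis using c by (auto simp: Cc_iff)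
qed

text \<open>It suffices to check multiplication by generators on the left: linearity gives all of
  the left multiplications, and the involution exchanges left and right.\<close>

lemma two_sided_idealI:
  assumes "I \<subseteq> Cc G" "0 \<in> I" "\<And>a b. a \<in> I \<Longrightarrow> b \<in> I \<Longrightarrow> a + b \<in> I" "\<And>a. a \<in> I \<Longrightarrow> - a \<in> I"
    and star: "\<And>a. a \<in> I \<Longrightarrow> star a \<in> I"
    and gen: "\<And>g a. g \<in> Cc_generators G \<Longrightarrow> a \<in> I \<Longrightarrow> convolution G g a \<in> I"
  shows "two_sided_ideal (Cc G) (convolution G) I"
proof -
  have left: "convolution G x a \<in> I" if "x \<in> Cc G" "a \<in> I" for x a
    using that(1)
  proof (induction rule: Cc_induct)
    case zero
    have "convolution G 0 a = 0" by (auto simp: convolution_def fun_eq_iff)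
    then show ?case using assms(2) by (simp only:)
  next
    case (add f g)
    have "convolution G (f + g) a = convolution G f a + convolution G g a"
      using add(1,2) Cc_generators_subset by (intro convolution_add_left Cc_fibre_finite) auto
    then show ?case using assms(3) gen[OF add(1) that(2)] add(3) by metis
  qed
  have "convolution G a x \<in> I" if "x \<in> Cc G" "a \<in> I" for x a
  proof -
    have "convolution G a x = star (star (convolution G a x))" by (simp add: star_star)
    also have "\<dots> = star (convolution G (star x) (star a))" by (simp add: star_convolution)
    also have "\<dots> \<in> I" using that left star Cc_star by blast
    finally show ?thesis .
  qed
  then show ?thesis using assms(1-4) left by (auto simp: two_sided_ideal_def)
qed


section \<open>Simplicity\<close>

lemma Cc_uminus: "f \<in> Cc G \<Longrightarrow> - f \<in> Cc G"
  unfolding Cc_def by (rule cfun.span_neg)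

lemma Cc_generatorsE:
  assumes "g \<in> Cc_generators G"
  obtains U where "bisection G U" "\<And>y. y \<notin> U \<Longrightarrow> g y = 0" "U \<subseteq> arrows G"
proof -
  obtain U where "compact_open_bisection U" "\<And>y. y \<notin> U \<Longrightarrow> g y = 0"
    using assms unfolding Cc_generators_iff by blast
  then show ?thesis using that compact_open_bisectionD(3,4) by blast
qed

lemma indicator_in_Cc: "compact_open_bisection U \<Longrightarrow> indicator U \<in> Cc G"
  using indicator_in_Cc_generators Cc_generators_subset by blast

section \<open>Simplicity implies minimality\<close>

lemma minimal_if_simple:
  assumes simple: "simple_ring (Cc G) (convolution G)"
  shows "minimal G"
  unfolding minimal_def
proof (intro allI impI)
  fix D assume D: "openin (unit_space G) D \<and> invariant_units G D"
  have oD: "openin X D" "D \<subseteq> units G" using D by (simp_all add: openin_unit_space)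
  have inv: "src x \<in> D \<longleftrightarrow> rng x \<in> D" if "x \<in> arrows G" for x
    using D that by (simp add: invariant_units_def)
  define I where "I = {f \<in> Cc G. \<forall>x \<in> arrows G. f x \<noteq> 0 \<longrightarrow> src x \<in> D}"
  have "two_sided_ideal (Cc G) (convolution G) I"
  proof (rule two_sided_idealI)
    show "0 \<in> I" unfolding I_def Cc_def using cfun.span_zero by simp
    show "a + b \<in> I" if "a \<in> I" "b \<in> I" for a b
    proof -
      have "src x \<in> D" if "x \<in> arrows G" "(a + b) x \<noteq> 0" for x
        using that \<open>a \<in> I\<close> \<open>b \<in> I\<close> by (cases "a x = 0") (auto simp: I_def)
      then show ?thesis using that Cc_add[of a b] by (simp add: I_def)
    qed
    show "- a \<in> I" if "a \<in> I" for a
      using that Cc_uminus[of a] by (simp add: I_def)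
    \<comment> \<open>Invariance of \<open>D\<close> enters here, as inversion exchanges source and
      range. Left multiplication does not change the source of \<open>x\<close>.\<close>
    show "star a \<in> I" if "a \<in> I" for a
    proof -
      have "src x \<in> D" if "x \<in> arrows G" "star a x \<noteq> 0" for x
      proof -
        have "src (iv x) \<in> D" using that \<open>a \<in> I\<close> by (simp add: star_def I_def del: src_iv)
        then show ?thesis using that inv by simp
      qed
      then show ?thesis using that Cc_star[of a] by (simp add: I_def)
    qed
    show "convolution G g a \<in> I" if g: "g \<in> Cc_generators G" and a: "a \<in> I" for g a
    proof -
      obtain U where U: "bisection G U" "\<And>y. y \<notin> U \<Longrightarrow> g y = 0" "U \<subseteq> arrows G"
        using Cc_generatorsE[OF g] by blast
      have "src x \<in> D" if x: "x \<in> arrows G" "convolution G g a x \<noteq> 0" for x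
      proof -
        have "rng x \<in> rng ` U" using convolution_bisection_zero[of U g x a] U(2) x(2) by blast
        then obtain b where b: "b \<in> U" "rng b = rng x" by (metis imageE)
        have "b \<in> arrows G" using b U(3) by blast
        have "a (iv b \<cdot> x) \<noteq> 0"
          using convolution_bisection[where g = a, OF U(1,2) b x(1)] x(2) by auto
        then have "src (iv b \<cdot> x) \<in> D"
          using a \<open>b \<in> arrows G\<close> b(2) x(1) by (simp add: I_def del: src_mult)
        then show ?thesis using \<open>b \<in> arrows G\<close> b(2) x(1) by simp
      qed
      moreover have "convolution G g a \<in> Cc G"
        using convolution_generator_Cc[OF g] a by (simp add: I_def)
      ultimately show ?thesis by (simp add: I_def)
    qed
  qed (auto simp: I_def)
  then consider "I = {0}" | "I = Cc G" using simple by (auto simp: simple_ring_def)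
  then show "D = {} \<or> D = units G"
  proof cases
    case 1
    have False if u: "u \<in> D" for u
    proof -
      obtain W where W: "compact_open_bisection W" "u \<in> W" "W \<subseteq> D"
        using compact_open_in_units[OF oD u] by blast
      have "src x \<in> D" if "x \<in> W" for x
        using that W(3) oD(2) by (metis src_unit subsetD)
      then have "indicator W \<in> I"
        using indicator_in_Cc[OF W(1)] by (auto simp: I_def indicator_def)
      then have "indicator W u = (0 :: complex)" using 1 by (metis singletonD zero_fun_apply)
      then show False using W(2) by simp
    qed
    then show ?thesis by blast
  next
    case 2
    have "u \<in> D" if u: "u \<in> units G" for u
    proof -
      obtain W where W: "compact_open_bisection W" "u \<in> W" "W \<subseteq> units G"
        using compact_open_in_units[OF openin_units subset_refl u] by blast
      then have "indicator W \<in> I" using 2 indicator_in_Cc by blast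
      then have "\<forall>x\<in>arrows G. x \<in> W \<longrightarrow> src x \<in> D" by (simp add: I_def indicator_def)
      then have "src u \<in> D" using W(2) units_arrow[OF u] by blast
      then show ?thesis using u by simp
    qed
    then show ?thesis using oD(2) by blast
  qed
qed

section \<open>Simplicity implies effectiveness\<close>

text \<open>The functions \<open>f\<close> with \<open>hom_sum f = 0\<close> are those that act as zero on the finitely
  supported functions on the unit space via \<open>f \<delta>\<^sub>u = (\<Sum>v. hom_sum f u v \<delta>\<^sub>v)\<close>.\<close>

definition hom_sum :: "('a \<Rightarrow> complex) \<Rightarrow> 'a \<Rightarrow> 'a \<Rightarrow> complex" where
  "hom_sum f u v = (\<Sum>x\<in>{x \<in> arrows G. src x = u \<and> rng x = v \<and> f x \<noteq> 0}. f x)"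

lemma hom_sum_eq:
  assumes "finite A" "A \<subseteq> {x \<in> arrows G. src x = u \<and> rng x = v}"
    and "\<And>x. x \<in> arrows G \<Longrightarrow> src x = u \<Longrightarrow> rng x = v \<Longrightarrow> f x \<noteq> 0 \<Longrightarrow> x \<in> A"
  shows "hom_sum f u v = sum f A"
  unfolding hom_sum_def by (rule sum.mono_neutral_left) (use assms in auto)

lemma hom_sum_add:
  assumes "fibre_finite f" "fibre_finite g"
  shows "hom_sum (f + g) u v = hom_sum f u v + hom_sum g u v"
proof -
  define A where "A = {x \<in> arrows G. src x = u \<and> rng x = v \<and> (f x \<noteq> 0 \<or> g x \<noteq> 0)}"
  have "A \<subseteq> {b \<in> arrows G. rng b = v \<and> f b \<noteq> 0} \<union> {b \<in> arrows G. rng b = v \<and> g b \<noteq> 0}"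
    by (auto simp: A_def)
  then have "finite A"
    using assms unfolding fibre_finite_def by (metis (no_types, lifting) finite_Un finite_subset)
  then have "hom_sum h u v = sum h A" if "h \<in> {f, g, f + g}" for h
    by (rule hom_sum_eq) (use that in \<open>auto simp: A_def\<close>)
  then show ?thesis by (simp add: sum.distrib)
qed

lemma hom_sum_uminus: "hom_sum (- f) u v = - hom_sum f u v"
  by (simp add: hom_sum_def sum_negf)

lemma hom_sum_star: "hom_sum (star f) u v = hom_sum f v u"
  unfolding hom_sum_def
  by (rule sum.reindex_bij_witness[where i = iv and j = iv]) (auto simp: star_def)

text \<open>If \<open>b\<close> is the arrow of \<open>U\<close> with range \<open>v\<close>, then
  multiplication by \<open>b\<close> is a bijection from the arrows from \<open>u\<close> to
  \<open>src b\<close> onto those from \<open>u\<close> to \<open>v\<close>, so the sum is only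
  scaled by \<open>g b\<close>.\<close>

lemma hom_sum_convolution:
  assumes U: "bisection G U" "\<And>y. y \<notin> U \<Longrightarrow> g y = 0" and f: "\<And>u v. hom_sum f u v = 0"
  shows "hom_sum (convolution G g f) u v = 0"
proof (cases "\<exists>b\<in>U. rng b = v \<and> g b \<noteq> 0")
  case True
  then obtain b where b: "b \<in> U" "rng b = v" "g b \<noteq> 0" by blast
  have ba: "b \<in> arrows G" using U(1) b(1) by (auto simp: bisection_def)
  have c: "convolution G g f x = g b * f (iv b \<cdot> x)" if "x \<in> arrows G" "rng x = v" for x
    using convolution_bisection[OF U b(1)] b(2) that by simp
  have "hom_sum (convolution G g f) u v =
      (\<Sum>y\<in>{y \<in> arrows G. src y = u \<and> rng y = src b \<and> f y \<noteq> 0}. g b * f y)"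
    unfolding hom_sum_def
  proof (rule sum.reindex_bij_witness[where i = "\<lambda>y. b \<cdot> y" and j = "\<lambda>x. iv b \<cdot> x"], goal_cases)
    case (1 x) then show ?case using ba b(2) by simp
  next
    case (2 x) then show ?case using ba b c[of x] by auto
  next
    case (3 y) then show ?case using ba by simp
  next
    case (4 y) then show ?case using ba b c by simp
  next
    case (5 x) then show ?case using c by simp
  qed
  also have "\<dots> = g b * hom_sum f u (src b)" by (simp add: hom_sum_def sum_distrib_left)
  finally show ?thesis using f by simp
next
  case False
  have "convolution G g f x = 0" if "x \<in> arrows G" "rng x = v" for x
  proof (cases "rng x \<in> rng ` U")
    case True
    then obtain b where b: "b \<in> U" "rng b = rng x" by (metis imageE)
    then show ?thesis using convolution_bisection[OF U b that(1)] False that(2) by simp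
  next
    case False
    then show ?thesis using convolution_bisection_zero[of U g x f] U(2) by blast
  qed
  then show ?thesis unfolding hom_sum_def by (intro sum.neutral) blast
qed

text \<open>The right-hand side depends only on the ranges of \<open>B\<close>, so \<open>B\<close>
  and its set of ranges act in the same way.\<close>

lemma hom_sum_indicator:
  assumes "bisection G B" "B \<subseteq> isotropy G"
  shows "hom_sum (indicator B) u v = (if u = v \<and> u \<in> rng ` B then 1 else 0)"
proof (cases "u = v \<and> u \<in> rng ` B")
  case True
  then obtain b where b: "b \<in> B" "u = rng b" by blast
  have uv: "u = v" using True by blast
  have bi: "b \<in> arrows G" "src b = rng b" using b(1) assms(2) unfolding isotropy_def by blast+
  have "hom_sum (indicator B) u v = sum (indicator B) {b}"
  proof (rule hom_sum_eq)
    show "{b} \<subseteq> {x \<in> arrows G. src x = u \<and> rng x = v}" using bi b(2) uv by blast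
  next
    fix x assume "rng x = v" "indicator B x \<noteq> (0::complex)"
    then have "x \<in> B" "rng x = rng b" using uv b(2) by (simp_all add: indicator_eq_0_iff)
    then show "x \<in> {b}" using assms(1) b(1) unfolding bisection_def inj_on_def by blast
  qed simp
  also have "\<dots> = 1" using b(1) by simp
  finally show ?thesis unfolding if_P[OF True] .
next
  case False
  have "hom_sum (indicator B) u v = sum (indicator B) {}"
  proof (rule hom_sum_eq)
    fix x assume "x \<in> arrows G" "src x = u" "rng x = v" "indicator B x \<noteq> (0::complex)"
    then have "x \<in> B" by (simp add: indicator_eq_0_iff)
    then have "src x = rng x" using assms(2) unfolding isotropy_def by blast
    then have "u = v" "u \<in> rng ` B" using \<open>x \<in> B\<close> \<open>src x = u\<close> \<open>rng x = v\<close> by blast+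
    then show "x \<in> {}" using False by blast
  qed auto
  then show ?thesis unfolding if_not_P[OF False] by simp
qed

lemma units_subset_isotropy: "units G \<subseteq> isotropy G"
  by (auto simp: isotropy_def)

lemma effective_if_simple:
  assumes simple: "simple_ring (Cc G) (convolution G)"
  shows "effective G"
  unfolding effective_def
proof
  show "units G \<subseteq> X interior_of isotropy G"
    by (rule interior_of_maximal[OF units_subset_isotropy openin_units])
  show "X interior_of isotropy G \<subseteq> units G"
  proof (rule ccontr)
    assume "\<not> X interior_of isotropy G \<subseteq> units G"
    then obtain x where x: "x \<in> X interior_of isotropy G" "x \<notin> units G" by blast
    obtain B where B: "compact_open_bisection B" "x \<in> B" "B \<subseteq> X interior_of isotropy G"
      by (rule compact_open_bisection_basis[OF openin_interior_of x(1)])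
    have Bi: "B \<subseteq> isotropy G" by (rule subset_trans[OF B(3) interior_of_subset])
    note D = compact_open_bisectionD[OF B(1)]
    have rB: "compact_open_bisection (rng ` B)" by (rule compact_open_bisection_rng_image[OF B(1)])
    have ru: "rng ` B \<subseteq> units G" using D(4) by auto
    have ri: "rng ` B \<subseteq> isotropy G" using ru units_subset_isotropy by blast
    have rr: "rng ` rng ` B = rng ` B"
    proof -
      have "rng (rng y) = rng y" if "y \<in> B" for y using that D(4) by auto
      then show ?thesis by (simp add: image_image)
    qed
    define I where "I = {f \<in> Cc G. \<forall>u v. hom_sum f u v = 0}"
    have "two_sided_ideal (Cc G) (convolution G) I"
    proof (rule two_sided_idealI)
      show "0 \<in> I" unfolding I_def Cc_def using cfun.span_zero by (simp add: hom_sum_def)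
      show "a + b \<in> I" if "a \<in> I" "b \<in> I" for a b
        using that Cc_add[of a b] hom_sum_add[of a b] Cc_fibre_finite by (simp add: I_def)
      show "- a \<in> I" if "a \<in> I" for a
        using that Cc_uminus[of a] hom_sum_uminus[of a] by (simp add: I_def)
      show "star a \<in> I" if "a \<in> I" for a
        using that Cc_star[of a] hom_sum_star[of a] by (simp add: I_def)
      show "convolution G g a \<in> I" if g: "g \<in> Cc_generators G" and a: "a \<in> I" for g a
      proof -
        obtain U where U: "bisection G U" "\<And>y. y \<notin> U \<Longrightarrow> g y = 0" "U \<subseteq> arrows G"
          using Cc_generatorsE[OF g] by blast
        have "hom_sum (convolution G g a) u v = 0" for u v
          by (rule hom_sum_convolution[OF U(1,2)]) (use a in \<open>simp_all add: I_def\<close>)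
        then show ?thesis using convolution_generator_Cc[OF g] a by (simp add: I_def)
      qed
    qed (auto simp: I_def)
    then consider "I = {0}" | "I = Cc G" using simple by (auto simp: simple_ring_def)
    then show False
    proof cases
      case 1
      \<comment> \<open>The two actions cancel, yet the value at \<open>x\<close> is 1, because
        \<open>x\<close> lies in \<open>B\<close> and is not a unit.\<close>
      let ?f = "indicator B + - indicator (rng ` B) :: 'a \<Rightarrow> complex"
      have c: "indicator B \<in> Cc G" "- indicator (rng ` B) \<in> Cc G"
        using B(1) rB by (simp_all only: indicator_in_Cc Cc_uminus)
      have "hom_sum ?f u v = 0" for u v
        unfolding hom_sum_add[OF Cc_fibre_finite[OF c(1)] Cc_fibre_finite[OF c(2)]] hom_sum_uminus
          hom_sum_indicator[OF D(3) Bi] hom_sum_indicator[OF compact_open_bisectionD(3)[OF rB] ri] rr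
        by simp
      then have "?f \<in> I" using Cc_add[OF c] unfolding I_def by blast
      then have "?f x = 0" using 1 by (metis singletonD zero_fun_apply)
      then show False using B(2) x(2) ru by (auto simp: indicator_def split: if_splits)
    next
      case 2
      \<comment> \<open>The kernel is proper: the indicator of a set of units acts as the identity
        at each of its points.\<close>
      then have "indicator (rng ` B) \<in> I" using indicator_in_Cc[OF rB] by blast
      then have "hom_sum (indicator (rng ` B)) (rng x) (rng x) = 0" by (simp add: I_def)
      then show False
        unfolding hom_sum_indicator[OF compact_open_bisectionD(3)[OF rB] ri] rr using B(2) by simp
    qed
  qed
qed

section \<open>Minimality and effectiveness imply simplicity\<close>

text \<open>Let \<open>S\<close> be the open set of non-units of \<open>U\<close> with both ends in
  \<open>V\<close>. If it lies in the isotropy, effectiveness empties it and \<open>V\<close> itself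
  works. Otherwise some arrow in it has distinct ends, which can be separated by disjoint open
  sets.\<close>

lemma effective_shrink_bisection:
  assumes eff: "effective G" and U: "compact_open_bisection U"
    and V: "openin X V" "V \<noteq> {}"
  obtains V' where "openin X V'" "V' \<noteq> {}" "V' \<subseteq> V"
    "\<And>x. x \<in> U \<Longrightarrow> x \<notin> units G \<Longrightarrow> rng x \<in> V' \<Longrightarrow> src x \<notin> V'"
proof -
  note D = compact_open_bisectionD[OF U]
  define S where "S = {x \<in> {x \<in> U - units G. rng x \<in> V}. src x \<in> V}"
  have oS: "openin X S"
    unfolding S_def by (intro openin_preimage openin_diff D(1) closedin_units V(1))
  show ?thesis
  proof (cases "S \<subseteq> isotropy G")
    case True
    then have "S \<subseteq> units G"
      using interior_of_maximal[OF True oS] eff by (simp add: effective_def)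
    then have "S = {}" by (auto simp: S_def)
    then show ?thesis using V by (intro that[of V]) (auto simp: S_def)
  next
    case False
    then obtain x where x: "x \<in> S" "src x \<noteq> rng x"
      using D(4) by (auto simp: isotropy_def S_def)
    have xU: "x \<in> U" "rng x \<in> V" using x(1) by (simp_all add: S_def)
    have "rng x \<in> topspace X" "src x \<in> topspace X"
      using xU(1) D(4) by (auto simp: topspace_arrow_topology)
    then obtain P Q where PQ: "openin X P" "openin X Q" "rng x \<in> P" "src x \<in> Q" "disjnt P Q"
      using Hausdorff_arrows x(2) unfolding Hausdorff_space_def by metis
    \<comment> \<open>Near \<open>x\<close> all arrows of \<open>U\<close> run from \<open>Q\<close>
      to \<open>P\<close>; their ranges form the new set.\<close>
    define N where "N = {y \<in> {y \<in> U. rng y \<in> P \<inter> V}. src y \<in> Q}"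
    have "openin X N" unfolding N_def by (intro openin_preimage openin_Int D(1) PQ V(1))
    then have "openin X (rng ` N)" by (rule openin_rng_image)
    moreover have "rng ` N \<noteq> {}" using xU PQ by (auto simp: N_def)
    moreover have "rng ` N \<subseteq> P \<inter> V" by (auto simp: N_def)
    moreover have "src y \<notin> rng ` N" if y: "y \<in> U" "rng y \<in> rng ` N" for y
    proof -
      obtain z where z: "z \<in> N" "rng y = rng z" using y(2) by (metis imageE)
      then have "y = z" using D(3) y(1) by (auto simp: bisection_def N_def dest: inj_onD)
      then have "src y \<in> Q" using z(1) by (simp add: N_def)
      then show ?thesis using PQ(5) \<open>rng ` N \<subseteq> P \<inter> V\<close> by (auto simp: disjnt_iff)
    qed
    ultimately show ?thesis by (intro that[of "rng ` N"]) auto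
  qed
qed

text \<open>The conclusion for one summand passes to smaller sets, so \<open>V\<close> can be shrunk
  successively for the finitely many generators that sum to \<open>f\<close>.\<close>

lemma effective_shrink:
  assumes eff: "effective G" and f: "f \<in> Cc G" and V: "openin X V" "V \<noteq> {}"
  shows "\<exists>V'. openin X V' \<and> V' \<noteq> {} \<and> V' \<subseteq> V \<and>
    (\<forall>x. x \<notin> units G \<and> rng x \<in> V' \<and> src x \<in> V' \<longrightarrow> f x = 0)"
  using f
proof (induction rule: Cc_induct)
  case zero
  show ?case using V by (intro exI[of _ V]) simp
next
  case (add g h)
  then obtain V1 where V1: "openin X V1" "V1 \<noteq> {}" "V1 \<subseteq> V"
    "\<forall>x. x \<notin> units G \<and> rng x \<in> V1 \<and> src x \<in> V1 \<longrightarrow> h x = 0" by blast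
  obtain U where U: "compact_open_bisection U" "\<And>x. x \<notin> U \<Longrightarrow> g x = 0"
    using add(1) unfolding Cc_generators_iff by blast
  obtain V2 where V2: "openin X V2" "V2 \<noteq> {}" "V2 \<subseteq> V1"
    "\<And>x. x \<in> U \<Longrightarrow> x \<notin> units G \<Longrightarrow> rng x \<in> V2 \<Longrightarrow> src x \<notin> V2"
    using effective_shrink_bisection[OF eff U(1) V1(1,2)] by metis
  have "(g + h) x = 0" if "x \<notin> units G" "rng x \<in> V2" "src x \<in> V2" for x
  proof -
    have "g x = 0" using V2(4)[of x] U(2)[of x] that by blast
    moreover have "h x = 0" using V1(4) V2(3) that by blast
    ultimately show ?thesis by simp
  qed
  then show ?case using V1(3) V2(1-3) by (intro exI[of _ V2]) blast
qed

lemma ideal_contains_indicator: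
  assumes eff: "effective G" and I: "two_sided_ideal (Cc G) (convolution G) I" and nz: "I \<noteq> {0}"
  obtains W where "compact_open_bisection W" "W \<noteq> {}" "W \<subseteq> units G" "indicator W \<in> I"
proof -
  have sub: "I \<subseteq> Cc G" and "0 \<in> I"
    and left: "\<And>g a. g \<in> Cc G \<Longrightarrow> a \<in> I \<Longrightarrow> convolution G g a \<in> I"
    and right: "\<And>g a. g \<in> Cc G \<Longrightarrow> a \<in> I \<Longrightarrow> convolution G a g \<in> I"
    using I by (simp_all add: two_sided_ideal_def)
  obtain f where f: "f \<in> I" "f \<noteq> 0" using nz \<open>0 \<in> I\<close> by blast
  then obtain x where x: "f x \<noteq> 0" by (auto simp: fun_eq_iff)
  then have xa: "x \<in> arrows G" using Cc_outside f(1) sub by blast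
  have "iv x \<in> topspace X" using xa by (simp add: topspace_arrow_topology)
  obtain B where B: "compact_open_bisection B" "iv x \<in> B" "B \<subseteq> topspace X"
    by (rule compact_open_bisection_basis[OF openin_topspace \<open>iv x \<in> topspace X\<close>])
  \<comment> \<open>At \<open>src x\<close> the only left factor in \<open>B\<close> is
    \<open>iv x\<close>, so \<open>f1\<close> takes there the nonzero value
    \<open>f x\<close>.\<close>
  define f1 where "f1 = convolution G (indicator B) f"
  have f1: "f1 \<in> I" unfolding f1_def by (intro left indicator_in_Cc B(1) f(1))
  then have f1C: "f1 \<in> Cc G" using sub by blast
  have "f1 (src x) = indicator B (iv x) * f (iv (iv x) \<cdot> src x)"
    unfolding f1_def
    by (rule convolution_bisection[OF compact_open_bisectionD(3)[OF B(1)]])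
      (use B(2) xa in simp_all)
  then have f1x: "f1 (src x) \<noteq> 0" using B(2) xa x by simp
  define V where "V = {u \<in> units G. f1 u \<in> - {0}}"
  have "openin X V"
    unfolding V_def using f1C
    by (intro openin_continuous_map_preimage_gen[OF _ openin_units]) (auto simp: Cc_iff)
  moreover have "src x \<in> V" using f1x xa by (simp add: V_def)
  ultimately obtain V' where V': "openin X V'" "V' \<noteq> {}" "V' \<subseteq> V"
    "\<And>x. x \<notin> units G \<Longrightarrow> rng x \<in> V' \<Longrightarrow> src x \<in> V' \<Longrightarrow> f1 x = 0"
    using effective_shrink[OF eff f1C, of V] by (metis empty_iff)
  obtain w where w: "w \<in> V'" using V'(2) by blast
  have V'u: "V' \<subseteq> units G" using V'(3) by (auto simp: V_def)
  obtain W where W: "compact_open_bisection W" "w \<in> W" "W \<subseteq> V'"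
    using compact_open_in_units[OF V'(1) V'u w] by blast
  have Wu: "W \<subseteq> units G" using W(3) V'u by blast
  have W0: "f1 y \<noteq> 0" if "y \<in> W" for y using that W(3) V'(3) by (auto simp: V_def)
  \<comment> \<open>Cutting on both sides keeps only arrows with range and source in
    \<open>W\<close>; by the choice of \<open>V'\<close> only units contribute.\<close>
  define f2 where "f2 = convolution G (indicator W) (convolution G f1 (indicator W))"
  have f2: "f2 \<in> I" unfolding f2_def by (intro left right indicator_in_Cc W(1) f1)
  have indW: "indicator W y = (0 :: complex)" if "y \<notin> units G" for y
    using that Wu by (auto simp: indicator_eq_0_iff)
  have f2_eq: "f2 y = (if y \<in> W then f1 y else 0)" if y: "y \<in> arrows G" for y
  proof -
    have eq: "f2 y = indicator W (rng y) * (f1 y * indicator W (src y))"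
      unfolding f2_def
      using convolution_units_left[of "indicator W" y "convolution G f1 (indicator W)"] indW y
        convolution_units_right[of "indicator W" y f1] by presburger
    show ?thesis
    proof (cases "y \<in> units G")
      case True
      then show ?thesis unfolding eq by simp
    next
      case False
      then have "y \<notin> W" using Wu by blast
      then show ?thesis unfolding eq using V'(4)[OF False] W(3) by (auto simp: indicator_def)
    qed
  qed
  \<comment> \<open>The inverse of \<open>f1\<close> on \<open>W\<close>, extended by zero; it is
    continuous because \<open>W\<close> is clopen and \<open>f1\<close> has no zero there.\<close>
  define h where "h = (\<lambda>y. if y \<in> W then inverse (f1 y) else 0)"
  have "continuous_map (subtopology X W) euclidean (\<lambda>y. inverse (f1 y))"
    using f1C W0 by (intro continuous_map_complex_inverse continuous_map_from_subtopology)
      (simp_all add: Cc_iff)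
  then have "continuous_map X euclidean h"
    unfolding h_def by (intro continuous_map_restrict_clopen
        compact_open_bisectionD(1)[OF W(1)] closedin_compact_open_bisection[OF W(1)])
  then have "h \<in> Cc_generators G"
    unfolding Cc_generators_iff using W(1) by (intro exI[of _ W]) (simp add: h_def)
  then have "convolution G h f2 \<in> I" using left f2 Cc_generators_subset by blast
  moreover have "convolution G h f2 = indicator W"
  proof
    fix y
    show "convolution G h f2 y = indicator W y"
    proof (cases "y \<in> arrows G")
      case True
      have "convolution G h f2 y = h (rng y) * f2 y"
        by (rule convolution_units_left[OF _ True]) (use Wu in \<open>auto simp: h_def\<close>)
      also have "\<dots> = indicator W y"
      proof (cases "y \<in> W")
        case True
        then have "rng y = y" using Wu by auto
        then show ?thesis using True f2_eq[OF \<open>y \<in> arrows G\<close>] W0[OF True] by (simp add: h_def)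
      next
        case False
        then show ?thesis using f2_eq[OF True] by simp
      qed
      finally show ?thesis .
    next
      case False
      then have "y \<notin> W" using Wu by auto
      then show ?thesis using False by simp
    qed
  qed
  ultimately show ?thesis using W(1,2) Wu by (intro that[of W]) auto
qed

text \<open>Inclusion-exclusion: convolution of functions on the units is pointwise, so the
  indicator of the overlap is a product and stays in \<open>I\<close>.\<close>

lemma indicator_Union_in_ideal:
  assumes I: "two_sided_ideal (Cc G) (convolution G) I"
    and "finite F" "\<And>W. W \<in> F \<Longrightarrow> W \<subseteq> units G \<and> indicator W \<in> I"
  shows "indicator (\<Union>F) \<in> I"
  using assms(2,3)
proof (induction rule: finite_induct)
  case empty
  have "indicator {} = (0 :: 'a \<Rightarrow> complex)" by (auto simp: fun_eq_iff)
  moreover have "0 \<in> I" using I by (simp add: two_sided_ideal_def)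
  ultimately show ?case by (metis Union_empty)
next
  case (insert W F)
  let ?A = "indicator W :: 'a \<Rightarrow> complex" and ?B = "indicator (\<Union>F) :: 'a \<Rightarrow> complex"
  have W: "W \<subseteq> units G" and WI: "?A \<in> I" using insert.prems by simp_all
  have FI: "?B \<in> I" and Fu: "\<Union>F \<subseteq> units G" using insert by auto
  have "convolution G ?A ?B x = ?A x * ?B x" for x
  proof (cases "x \<in> arrows G")
    case True
    have "convolution G ?A ?B x = ?A (rng x) * ?B x"
      by (rule convolution_units_left[OF _ True]) (use W in \<open>auto simp: indicator_def\<close>)
    also have "\<dots> = ?A x * ?B x"
    proof (cases "x \<in> units G")
      case False
      then have "?B x = 0" using Fu unfolding indicator_eq_0_iff by blast
      then show ?thesis by simp
    qed simp
    finally show ?thesis .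
  next
    case False
    then have "x \<notin> W" using W by auto
    then show ?thesis using False by simp
  qed
  then have eq: "indicator (\<Union>(insert W F)) = ?A + ?B + - convolution G ?A ?B"
    by (auto simp: fun_eq_iff indicator_def)
  have add: "a + b \<in> I" if "a \<in> I" "b \<in> I" for a b
    using I that unfolding two_sided_ideal_def by blast
  have "- convolution G ?A ?B \<in> I" using I WI FI unfolding two_sided_ideal_def by blast
  then show ?case unfolding eq by (intro add WI FI)
qed

lemma simple_if_minimal_effective:
  assumes min: "minimal G" and eff: "effective G"
  shows "simple_ring (Cc G) (convolution G)"
  unfolding simple_ring_def
proof (intro allI impI)
  fix I assume I: "two_sided_ideal (Cc G) (convolution G) I"
  then have sub: "I \<subseteq> Cc G" and zero: "0 \<in> I"
    and add: "\<And>a b. a \<in> I \<Longrightarrow> b \<in> I \<Longrightarrow> a + b \<in> I"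
    and left: "\<And>g a. g \<in> Cc G \<Longrightarrow> a \<in> I \<Longrightarrow> convolution G g a \<in> I"
    and right: "\<And>g a. g \<in> Cc G \<Longrightarrow> a \<in> I \<Longrightarrow> convolution G a g \<in> I"
    by (simp_all add: two_sided_ideal_def)
  show "I = {0} \<or> I = Cc G"
  proof (cases "I = {0}")
    case False
    define \<W> where "\<W> = {W. compact_open_bisection W \<and> W \<subseteq> units G \<and> indicator W \<in> I}"
    obtain W where "compact_open_bisection W" "W \<noteq> {}" "W \<subseteq> units G" "indicator W \<in> I"
      by (rule ideal_contains_indicator[OF eff I False])
    then have ne: "\<Union>\<W> \<noteq> {}" unfolding \<W>_def by blast
    have step: "rng x \<in> \<Union>\<W>" if x: "x \<in> arrows G" "src x \<in> \<Union>\<W>" for x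
    proof -
      obtain W where W: "compact_open_bisection W" "W \<subseteq> units G" "indicator W \<in> I" "src x \<in> W"
        using x(2) unfolding \<W>_def by blast
      have "openin X {y \<in> arrows G. src y \<in> W}"
        using openin_preimage(2)[OF openin_topspace compact_open_bisectionD(1)[OF W(1)]]
        by (simp add: topspace_arrow_topology)
      then obtain B where B: "compact_open_bisection B" "x \<in> B" "B \<subseteq> {y \<in> arrows G. src y \<in> W}"
        using compact_open_bisection_basis[of "{y \<in> arrows G. src y \<in> W}" x] x(1) W(4) by blast
      note D = compact_open_bisectionD[OF B(1)]
      \<comment> \<open>Every source of \<open>B\<close> lies in \<open>W\<close>, so
        \<open>indicator W\<close> acts on the right as an identity. Multiplying next by the
        indicator of the inverse bisection turns \<open>B\<close> into its ranges, which include
        \<open>rng x\<close>.\<close>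
      have "convolution G (indicator B) (indicator W) = indicator B"
      proof
        fix y
        show "convolution G (indicator B) (indicator W) y = indicator B y"
        proof (cases "y \<in> arrows G")
          case True
          have "convolution G (indicator B) (indicator W) y = indicator B y * indicator W (src y)"
            by (rule convolution_units_right[OF _ True]) (use W(2) in \<open>auto simp: indicator_def\<close>)
          then show ?thesis using B(3) by (auto simp: indicator_def)
        next
          case False
          then have "y \<notin> B" using D(4) by blast
          then show ?thesis using False by simp
        qed
      qed
      then have "indicator B \<in> I" using left[OF indicator_in_Cc[OF B(1)] W(3)] by simp
      moreover have "convolution G (indicator B) (indicator (iv ` B)) = indicator (rng ` B)"
      proof
        fix y
        show "convolution G (indicator B) (indicator (iv ` B)) y = indicator (rng ` B) y"
        proof (cases "rng y \<in> rng ` B \<and> y \<in> arrows G")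
          case True
          then obtain b where b: "b \<in> B" "rng b = rng y" by (metis imageE)
          have ba: "b \<in> arrows G" using b D(4) by blast
          have "iv b \<cdot> y \<in> iv ` B \<longleftrightarrow> y \<in> rng ` B"
          proof
            assume "iv b \<cdot> y \<in> iv ` B"
            then obtain c where c: "c \<in> B" "iv b \<cdot> y = iv c" by blast
            have ca: "c \<in> arrows G" using c D(4) by blast
            have "rng (iv b \<cdot> y) = src b" using ba b True by simp
            then have "src c = src b" using c(2) ca by simp
            then have "c = b" using D(3) b c by (auto simp: bisection_def dest: inj_onD)
            then have "y = b \<cdot> iv b" using c(2) mult_iv_cancel[of b y] ba b True by simp
            then have "y = rng b" by (simp add: range_map_def)
            then show "y \<in> rng ` B" using b(1) by blast
          next
            assume "y \<in> rng ` B"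
            then have "y \<in> units G" using D(4) by auto
            then have "y = src (iv b)" using b ba by simp
            then have "iv b \<cdot> y = iv b" using mult_src[of "iv b"] ba by (simp del: src_iv)
            then show "iv b \<cdot> y \<in> iv ` B" using b(1) by simp
          qed
          then show ?thesis
            using convolution_bisection[OF D(3) _ b, of "indicator B" "indicator (iv ` B) :: 'a \<Rightarrow> complex"] True b(1)
            by (simp add: indicator_def)
        next
          case False
          have "y \<notin> rng ` B"
          proof
            assume "y \<in> rng ` B"
            then have "y \<in> units G" using D(4) by auto
            then show False using False \<open>y \<in> rng ` B\<close> by simp
          qed
          moreover have "convolution G (indicator B) (indicator (iv ` B)) y = 0"
            using False convolution_bisection_zero[of B "indicator B" y] by (cases "y \<in> arrows G") auto
          ultimately show ?thesis by simp
        qed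
      qed
      ultimately have "indicator (rng ` B) \<in> I"
        using right[OF indicator_in_Cc[OF compact_open_bisection_iv[OF B(1)]]] by metis
      then have "rng ` B \<in> \<W>"
        using compact_open_bisection_rng_image[OF B(1)] D(4) by (auto simp: \<W>_def)
      then show ?thesis using B(2) by blast
    qed
    \<comment> \<open>The reverse implication is \<open>step\<close> applied to
      \<open>iv x\<close>.\<close>
    have "src x \<in> \<Union>\<W> \<longleftrightarrow> rng x \<in> \<Union>\<W>" if "x \<in> arrows G" for x
      using step[of x] step[of "iv x"] that by (metis inverse_closed rng_iv src_iv)
    moreover have Wu: "\<Union>\<W> \<subseteq> units G" unfolding \<W>_def by blast
    ultimately have inv: "invariant_units G (\<Union>\<W>)"
      unfolding invariant_units_def by (intro conjI ballI)
    have "openin X (\<Union>\<W>)"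
      by (rule openin_Union) (simp add: \<W>_def compact_open_bisection_def)
    then have "openin (unit_space G) (\<Union>\<W>)" using Wu unfolding openin_unit_space ..
    then have W_units: "\<Union>\<W> = units G"
      using min inv ne unfolding minimal_def by metis
    have gen: "f \<in> I" if f: "f \<in> Cc_generators G" for f
    proof -
      obtain U where U: "compact_open_bisection U" "\<And>x. x \<notin> U \<Longrightarrow> f x = 0"
        using f unfolding Cc_generators_iff by blast
      have "compactin X (rng ` U)"
        by (rule compact_open_bisectionD(2)[OF compact_open_bisection_rng_image[OF U(1)]])
      moreover have "rng ` U \<subseteq> \<Union>\<W>" unfolding W_units using compact_open_bisectionD(4)[OF U(1)] by auto
      \<comment> \<open>The ideal may lack the indicator of all units, but by compactness a finite
        union of these sets covers the ranges of \<open>U\<close>, and its indicator is a left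
        identity for \<open>f\<close>.\<close>
      ultimately obtain F where F: "finite F" "F \<subseteq> \<W>" "rng ` U \<subseteq> \<Union>F"
        using compactinD[of X "rng ` U" \<W>] unfolding \<W>_def compact_open_bisection_def by blast
      have FI: "indicator (\<Union>F) \<in> I"
        by (rule indicator_Union_in_ideal[OF I F(1)]) (use F(2) in \<open>auto simp: \<W>_def\<close>)
      have Fu: "\<Union>F \<subseteq> units G" using F(2) by (auto simp: \<W>_def)
      have "convolution G (indicator (\<Union>F)) f = f"
      proof
        fix x
        show "convolution G (indicator (\<Union>F)) f x = f x"
        proof (cases "x \<in> arrows G")
          case True
          have "convolution G (indicator (\<Union>F)) f x = indicator (\<Union>F) (rng x) * f x"
            by (rule convolution_units_left[OF _ True]) (use Fu in \<open>auto simp: indicator_eq_0_iff\<close>)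
          also have "\<dots> = f x"
          proof (cases "x \<in> U")
            case True
            then have "rng x \<in> \<Union>F" using F(3) by blast
            then show ?thesis by simp
          qed (simp add: U(2))
          finally show ?thesis .
        next
          case False
          then show ?thesis using compact_open_bisectionD(4)[OF U(1)] U(2)[of x] by auto
        qed
      qed
      then show ?thesis using right[OF _ FI, of f] f Cc_generators_subset by auto
    qed
    have "f \<in> I" if "f \<in> Cc G" for f
      using that
    proof (induction rule: Cc_induct)
      case zero
      show ?case by (rule \<open>0 \<in> I\<close>)
    next
      case (add f g)
      then show ?case using gen \<open>\<And>a b. a \<in> I \<Longrightarrow> b \<in> I \<Longrightarrow> a + b \<in> I\<close> by blast
    qed
    then show ?thesis using sub by blast
  qed simp
qed

end

theorem theorem6p4:
  fixes G :: "'a top_groupoid"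
  assumes "ample_groupoid G"
    and "Hausdorff_space (arrow_topology G)"
  shows "simple_ring (Cc G) (convolution G) \<longleftrightarrow> minimal G \<and> effective G"
proof -
  interpret hausdorff_ample_groupoid G
    using assms by (simp add: hausdorff_ample_groupoid_def hausdorff_ample_groupoid_axioms_def)
  show ?thesis
    using minimal_if_simple effective_if_simple simple_if_minimal_effective by blast
qed

end
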